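(* Let $Y$ be a submanifold of a contact manifold $(M, \xi = \ker \alpha)$. Then $Y$ is a contact coisotropic submanifold of $(M, \xi = \ker \alpha)$ if and only if $\mathbb{R} \times Y$ is a symplectic coisotropic submanifold of the symplectization $SM=(\mathbb{R} \times M, \omega = d(e^{\theta} \alpha))$, where $\theta$ is the coordinate on $\mathbb{R}$.
   Context: Contact manifolds are co-oriented: $\xi=\ker\alpha$ for a global 1-form $\alpha$ with $\alpha\wedge(d\alpha)^n$ a volume form on $M^{2n+1}$. A submanifold $Y \subset M$ is contact coisotropic if for every $p\in Y$, $(T_pY\cap\xi_p)^{\perp_{d\alpha}}\subset T_pY\cap \xi_p$, where $\perp_{d\alpha}$ denotes the symplectic orthogonal complement inside $\xi_p$ with respect to the non-degenerate form $d\alpha|_{\xi}$. A submanifold $W$ of a symplectic manifold is symplectic coisotropic if $(T_xW)^{\perp_\omega}\subset T_xW$ for all $x\in W$. *)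

theory Defs
  imports "HOL-Analysis.Analysis"
begin

section \<open>Smooth maps between Euclidean spaces\<close>

text \<open>Only used for open sets \<open>S\<close>. \<open>n\<close>-fold differentiability is iterated along directional
  derivatives, which in finite dimensions is the usual \<open>C\<close>-\<open>n\<close>.\<close>

fun times_differentiable_on ::
    "nat \<Rightarrow> 'a::euclidean_space set \<Rightarrow> ('a \<Rightarrow> 'b::euclidean_space) \<Rightarrow> bool" where
  "times_differentiable_on 0 S f \<longleftrightarrow> continuous_on S f"
| "times_differentiable_on (Suc n) S f \<longleftrightarrow>
     (\<forall>x\<in>S. f differentiable (at x)) \<and>
     (\<forall>v. times_differentiable_on n S (\<lambda>x. frechet_derivative f (at x) v))"

definition smooth_on :: "'a::euclidean_space set \<Rightarrow> ('a \<Rightarrow> 'b::euclidean_space) \<Rightarrow> bool" where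
  "smooth_on S f \<longleftrightarrow> (\<forall>n. times_differentiable_on n S f)"


section \<open>Smooth manifolds\<close>

text \<open>The underlying space of a manifold is a whole type \<open>'m\<close>; the smooth structure is given by an
  atlas \<open>A\<close>, which need not be maximal. A chart is its domain together with its coordinate map
  (values of the map outside the domain are irrelevant).\<close>

type_synonym ('m, 'e) chart = "'m set \<times> ('m \<Rightarrow> 'e)"

abbreviation chart_dom :: "('m, 'e) chart \<Rightarrow> 'm set" where
  "chart_dom c \<equiv> fst c"

abbreviation chart_map :: "('m, 'e) chart \<Rightarrow> 'm \<Rightarrow> 'e" where
  "chart_map c \<equiv> snd c"

definition chart_image :: "('m, 'e) chart \<Rightarrow> 'e set" where
  "chart_image c = chart_map c ` chart_dom c"

definition chart_inv :: "('m, 'e) chart \<Rightarrow> 'e \<Rightarrow> 'm" where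
  "chart_inv c = inv_into (chart_dom c) (chart_map c)"

definition is_chart :: "('m::topological_space, 'e::euclidean_space) chart \<Rightarrow> bool" where
  "is_chart c \<longleftrightarrow> open (chart_dom c) \<and> open (chart_image c) \<and>
     homeomorphism (chart_dom c) (chart_image c) (chart_map c) (chart_inv c)"

definition transition ::
    "('m, 'e::euclidean_space) chart \<Rightarrow> ('m, 'e) chart \<Rightarrow> 'e \<Rightarrow> 'e" where
  "transition c d = chart_map d \<circ> chart_inv c"

definition compatible ::
    "('m, 'e::euclidean_space) chart \<Rightarrow> ('m, 'e) chart \<Rightarrow> bool" where
  "compatible c d \<longleftrightarrow>
     smooth_on (chart_map c ` (chart_dom c \<inter> chart_dom d)) (transition c d) \<and>
     smooth_on (chart_map d ` (chart_dom c \<inter> chart_dom d)) (transition d c)"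

definition smooth_atlas :: "('m::topological_space, 'e::euclidean_space) chart set \<Rightarrow> bool" where
  "smooth_atlas A \<longleftrightarrow>
     (\<forall>c\<in>A. is_chart c) \<and> (\<Union>c\<in>A. chart_dom c) = UNIV \<and> (\<forall>c\<in>A. \<forall>d\<in>A. compatible c d)"

definition charts_at :: "('m, 'e) chart set \<Rightarrow> 'm \<Rightarrow> ('m, 'e) chart set" where
  "charts_at A p = {c \<in> A. p \<in> chart_dom c}"

text \<open>An arbitrary chart of the atlas around \<open>p\<close>; the notions below that use it do not depend on
  the choice.\<close>

definition chart_at :: "('m, 'e) chart set \<Rightarrow> 'm \<Rightarrow> ('m, 'e) chart" where
  "chart_at A p = (SOME c. c \<in> charts_at A p)"

definition prod_chart ::
    "('m, 'e) chart \<Rightarrow> ('n, 'f) chart \<Rightarrow> ('m \<times> 'n, 'e \<times> 'f) chart" where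
  "prod_chart c d = (chart_dom c \<times> chart_dom d, map_prod (chart_map c) (chart_map d))"

definition prod_atlas ::
    "('m, 'e) chart set \<Rightarrow> ('n, 'f) chart set \<Rightarrow> ('m \<times> 'n, 'e \<times> 'f) chart set" where
  "prod_atlas A B = {prod_chart c d | c d. c \<in> A \<and> d \<in> B}"

definition real_atlas :: "(real, real) chart set" where
  "real_atlas = {(UNIV, id)}"


section \<open>Tangent vectors\<close>

text \<open>A tangent vector at \<open>p\<close> is the family of its coordinate vectors in all charts of the atlas
  around \<open>p\<close>, related by the derivatives of the transition maps. Entries at other charts are set
  to 0, so that equality of tangent vectors is equality of functions and the vector space
  operations are pointwise.\<close>

type_synonym ('m, 'e) tvec = "('m, 'e) chart \<Rightarrow> 'e"

definition tangent_space ::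
    "('m, 'e::euclidean_space) chart set \<Rightarrow> 'm \<Rightarrow> ('m, 'e) tvec set" where
  "tangent_space A p =
     {v. (\<forall>c. c \<notin> charts_at A p \<longrightarrow> v c = 0) \<and>
         (\<forall>c\<in>charts_at A p. \<forall>d\<in>charts_at A p.
            v d = frechet_derivative (transition c d) (at (chart_map c p)) (v c))}"

text \<open>The tangent vector at \<open>p\<close> whose coordinate vector in the chart \<open>c\<close> is \<open>w\<close>.\<close>

definition coord_tvec ::
    "('m, 'e::euclidean_space) chart set \<Rightarrow> ('m, 'e) chart \<Rightarrow> 'm \<Rightarrow> 'e \<Rightarrow> ('m, 'e) tvec" where
  "coord_tvec A c p w =
     (\<lambda>d. if d \<in> charts_at A p then frechet_derivative (transition c d) (at (chart_map c p)) w
          else 0)"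

definition pushforward ::
    "('m, 'e::euclidean_space) chart set \<Rightarrow> ('n, 'f::euclidean_space) chart set \<Rightarrow>
     ('m \<Rightarrow> 'n) \<Rightarrow> 'm \<Rightarrow> ('m, 'e) tvec \<Rightarrow> ('n, 'f) tvec" where
  "pushforward A B f p v =
     (let c = chart_at A p in
      (\<lambda>d. if d \<in> charts_at B (f p)
           then frechet_derivative (chart_map d \<circ> f \<circ> chart_inv c) (at (chart_map c p)) (v c)
           else 0))"

definition smooth_curve ::
    "('m::topological_space, 'e::euclidean_space) chart set \<Rightarrow> real set \<Rightarrow> (real \<Rightarrow> 'm) \<Rightarrow> bool" where
  "smooth_curve A I \<gamma> \<longleftrightarrow>
     continuous_on I \<gamma> \<and> (\<forall>c\<in>A. smooth_on (I \<inter> \<gamma> -` chart_dom c) (chart_map c \<circ> \<gamma>))"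

definition velocity ::
    "('m, 'e::euclidean_space) chart set \<Rightarrow> (real \<Rightarrow> 'm) \<Rightarrow> real \<Rightarrow> ('m, 'e) tvec" where
  "velocity A \<gamma> t =
     (\<lambda>c. if c \<in> charts_at A (\<gamma> t) then vector_derivative (chart_map c \<circ> \<gamma>) (at t) else 0)"


section \<open>Submanifolds\<close>

text \<open>Embedded submanifolds without boundary, given by slice charts. A slice chart belongs to the
  maximal atlas, i.e. it is compatible with every chart of \<open>A\<close>.\<close>

definition slice_chart ::
    "('m::topological_space, 'e::euclidean_space) chart set \<Rightarrow> 'm set \<Rightarrow> nat \<Rightarrow> ('m, 'e) chart \<Rightarrow> bool"
  where
  "slice_chart A Y k c \<longleftrightarrow>
     is_chart c \<and> (\<forall>d\<in>A. compatible c d) \<and>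
     (\<exists>S. subspace S \<and> dim S = k \<and> chart_map c ` (chart_dom c \<inter> Y) = chart_image c \<inter> S)"

definition submanifold ::
    "('m::topological_space, 'e::euclidean_space) chart set \<Rightarrow> 'm set \<Rightarrow> bool" where
  "submanifold A Y \<longleftrightarrow> (\<exists>k. \<forall>p\<in>Y. \<exists>c. slice_chart A Y k c \<and> p \<in> chart_dom c)"

text \<open>The tangent space of \<open>Y\<close> at \<open>p\<close> as a subset of the tangent space of the ambient manifold:
  the velocities of smooth curves in \<open>Y\<close> through \<open>p\<close>.\<close>

definition sub_tangent_space ::
    "('m::topological_space, 'e::euclidean_space) chart set \<Rightarrow> 'm set \<Rightarrow> 'm \<Rightarrow> ('m, 'e) tvec set" where
  "sub_tangent_space A Y p =
     {velocity A \<gamma> 0 | \<gamma>. \<gamma> 0 = p \<and>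
        (\<exists>\<epsilon>>0. smooth_curve A {-\<epsilon><..<\<epsilon>} \<gamma> \<and> \<gamma> ` {-\<epsilon><..<\<epsilon>} \<subseteq> Y)}"


section \<open>Differential forms\<close>

type_synonym ('m, 'e) one_form = "'m \<Rightarrow> ('m, 'e) tvec \<Rightarrow> real"
type_synonym ('m, 'e) two_form = "'m \<Rightarrow> ('m, 'e) tvec \<Rightarrow> ('m, 'e) tvec \<Rightarrow> real"

definition local_form ::
    "('m, 'e::euclidean_space) chart set \<Rightarrow> ('m, 'e) one_form \<Rightarrow> ('m, 'e) chart \<Rightarrow> 'e \<Rightarrow> 'e \<Rightarrow> real"
  where
  "local_form A \<alpha> c x w = \<alpha> (chart_inv c x) (coord_tvec A c (chart_inv c x) w)"

text \<open>Since \<open>coord_tvec A c p\<close> is a linear isomorphism onto the tangent space at \<open>p\<close>, the linearity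
  condition below is linearity of \<open>\<alpha> p\<close> on the tangent space.\<close>

definition is_one_form ::
    "('m, 'e::euclidean_space) chart set \<Rightarrow> ('m, 'e) one_form \<Rightarrow> bool" where
  "is_one_form A \<alpha> \<longleftrightarrow>
     (\<forall>c\<in>A. (\<forall>x\<in>chart_image c. linear (local_form A \<alpha> c x)) \<and>
            (\<forall>w. smooth_on (chart_image c) (\<lambda>x. local_form A \<alpha> c x w)))"

definition pullback ::
    "('m, 'e::euclidean_space) chart set \<Rightarrow> ('n, 'f::euclidean_space) chart set \<Rightarrow>
     ('m \<Rightarrow> 'n) \<Rightarrow> ('n, 'f) one_form \<Rightarrow> ('m, 'e) one_form" where
  "pullback A B f \<alpha> p v = \<alpha> (f p) (pushforward A B f p v)"

text \<open>With \<open>\<alpha> = \<Sum>i. a\<^sub>i dx\<^sub>i\<close> in coordinates, this is \<open>\<Sum>i. da\<^sub>i \<and> dx\<^sub>i\<close> in the convention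
  \<open>d\<alpha>(X, Y) = X(\<alpha>(Y)) - Y(\<alpha>(X)) - \<alpha>([X, Y])\<close>, without a factor 1/2.\<close>

definition ext_deriv ::
    "('m, 'e::euclidean_space) chart set \<Rightarrow> ('m, 'e) one_form \<Rightarrow> ('m, 'e) two_form" where
  "ext_deriv A \<alpha> p u v =
     (let c = chart_at A p; x = chart_map c p in
        frechet_derivative (\<lambda>y. local_form A \<alpha> c y (v c)) (at x) (u c)
      - frechet_derivative (\<lambda>y. local_form A \<alpha> c y (u c)) (at x) (v c))"

text \<open>Exterior algebra at a single tangent space. A \<open>k\<close>-form takes its \<open>k\<close> arguments as the values
  of a sequence at \<open>0, \<dots>, k - 1\<close>.\<close>

definition wedge ::
    "nat \<Rightarrow> nat \<Rightarrow> ((nat \<Rightarrow> 'v) \<Rightarrow> real) \<Rightarrow> ((nat \<Rightarrow> 'v) \<Rightarrow> real) \<Rightarrow> (nat \<Rightarrow> 'v) \<Rightarrow> real" where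
  "wedge k l \<omega> \<eta> v =
     (\<Sum>\<sigma> | \<sigma> permutes {..<k + l}.
        of_int (sign \<sigma>) * \<omega> (\<lambda>i. v (\<sigma> i)) * \<eta> (\<lambda>i. v (\<sigma> (k + i)))) / (fact k * fact l)"

fun wedge_power :: "nat \<Rightarrow> ((nat \<Rightarrow> 'v) \<Rightarrow> real) \<Rightarrow> nat \<Rightarrow> (nat \<Rightarrow> 'v) \<Rightarrow> real" where
  "wedge_power k \<omega> 0 = (\<lambda>v. 1)"
| "wedge_power k \<omega> (Suc n) = wedge k (k * n) \<omega> (wedge_power k \<omega> n)"


section \<open>Contact manifolds and symplectizations\<close>

definition contact_volume ::
    "('m, 'e::euclidean_space) chart set \<Rightarrow> ('m, 'e) one_form \<Rightarrow> nat \<Rightarrow> 'm \<Rightarrow>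
     (nat \<Rightarrow> ('m, 'e) tvec) \<Rightarrow> real" where
  "contact_volume A \<alpha> n p =
     wedge 1 (2 * n) (\<lambda>v. \<alpha> p (v 0)) (wedge_power 2 (\<lambda>v. ext_deriv A \<alpha> p (v 0) (v 1)) n)"

definition contact_manifold ::
    "nat \<Rightarrow> ('m::{t2_space, second_countable_topology}, 'e::euclidean_space) chart set \<Rightarrow>
     ('m, 'e) one_form \<Rightarrow> bool" where
  "contact_manifold n A \<alpha> \<longleftrightarrow>
     smooth_atlas A \<and> DIM('e) = 2 * n + 1 \<and> is_one_form A \<alpha> \<and>
     (\<forall>p. \<exists>v. (\<forall>i. v i \<in> tangent_space A p) \<and> contact_volume A \<alpha> n p v \<noteq> 0)"

definition contact_hyperplane ::
    "('m, 'e::euclidean_space) chart set \<Rightarrow> ('m, 'e) one_form \<Rightarrow> 'm \<Rightarrow> ('m, 'e) tvec set" where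
  "contact_hyperplane A \<alpha> p = {v \<in> tangent_space A p. \<alpha> p v = 0}"

text \<open>The orthogonal complement of \<open>W\<close> inside \<open>V\<close> with respect to \<open>\<omega>\<close>.\<close>

definition orth_compl :: "'v set \<Rightarrow> ('v \<Rightarrow> 'v \<Rightarrow> real) \<Rightarrow> 'v set \<Rightarrow> 'v set" where
  "orth_compl V \<omega> W = {v \<in> V. \<forall>w\<in>W. \<omega> v w = 0}"

definition contact_coisotropic ::
    "('m::topological_space, 'e::euclidean_space) chart set \<Rightarrow> ('m, 'e) one_form \<Rightarrow> 'm set \<Rightarrow> bool"
  where
  "contact_coisotropic A \<alpha> Y \<longleftrightarrow> submanifold A Y \<and>
     (\<forall>p\<in>Y. orth_compl (contact_hyperplane A \<alpha> p) (ext_deriv A \<alpha> p)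
               (sub_tangent_space A Y p \<inter> contact_hyperplane A \<alpha> p)
             \<subseteq> sub_tangent_space A Y p \<inter> contact_hyperplane A \<alpha> p)"

definition symplectic_coisotropic ::
    "('m::topological_space, 'e::euclidean_space) chart set \<Rightarrow> ('m, 'e) two_form \<Rightarrow> 'm set \<Rightarrow> bool"
  where
  "symplectic_coisotropic A \<omega> W \<longleftrightarrow> submanifold A W \<and>
     (\<forall>x\<in>W. orth_compl (tangent_space A x) (\<omega> x) (sub_tangent_space A W x)
             \<subseteq> sub_tangent_space A W x)"

definition symplectization_atlas ::
    "('m, 'e::euclidean_space) chart set \<Rightarrow> (real \<times> 'm, real \<times> 'e) chart set" where
  "symplectization_atlas A = prod_atlas real_atlas A"

text \<open>The form \<open>d(e\<^sup>\<theta> \<alpha>)\<close>, where \<open>\<alpha>\<close> is pulled back along the projection to \<open>M\<close>.\<close>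

definition symplectization_form ::
    "('m, 'e::euclidean_space) chart set \<Rightarrow> ('m, 'e) one_form \<Rightarrow> (real \<times> 'm, real \<times> 'e) two_form"
  where
  "symplectization_form A \<alpha> =
     ext_deriv (symplectization_atlas A)
       (\<lambda>x v. exp (fst x) * pullback (symplectization_atlas A) A snd \<alpha> x v)"

end

theory Submission
  imports Defs
begin

text \<open>
  The equivalence holds at each point separately and is linear algebra once tangent spaces and forms
  are written in coordinates. Let \<open>K\<close> be the tangent space of \<open>Y\<close> at \<open>p\<close>. The tangent space of
  \<open>\<real> \<times> Y\<close> at \<open>(s, p)\<close> is \<open>\<real> \<times> K\<close>, and since \<open>d(e\<^sup>\<theta> \<alpha>) = e\<^sup>\<theta> (d\<theta> \<and> \<alpha> + d\<alpha>)\<close>, a vector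
  \<open>(r, x)\<close> is orthogonal to \<open>\<real> \<times> K\<close> iff \<open>\<alpha> x = 0\<close> and \<open>r * \<alpha> w + d\<alpha>(x, w) = 0\<close> for all \<open>w \<in> K\<close>.
  The projection of this orthogonal complement to \<open>x\<close> is the complement of \<open>K \<inter> \<xi>\<close> inside \<open>\<xi>\<close>:
  a functional \<open>d\<alpha>(x, \<cdot>)\<close> that vanishes on \<open>K \<inter> ker \<alpha>\<close> is a multiple of \<open>\<alpha>\<close> on \<open>K\<close>, and the multiple
  determines \<open>r\<close>. So one complement lies in \<open>\<real> \<times> K\<close> iff the other lies in \<open>K\<close>; this is
  \<open>linear_coisotropic_iff\<close>.

  Three facts make this argument available. First, the tangent space of a submanifold, given as
  a set of velocities of curves, is a linear subspace, and it has an explicit description in every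
  chart (\<open>mem_sub_tangent_space_iff\<close>). Second, \<open>d\<alpha>\<close> does not depend on the chart used to
  compute it (\<open>coord_ext_deriv_change_chart\<close>); this rests on the symmetry of second derivatives, which
  is proved from the mean value theorem. It is needed because the arbitrary charts entering the
  definitions of \<open>d\<alpha>\<close> on \<open>M\<close> and of \<open>d(e\<^sup>\<theta> \<alpha>)\<close> on \<open>\<real> \<times> M\<close> need not correspond to each other. Third,
  the atlas of the symplectization consists of cylinders over the charts of \<open>M\<close>, whose changes of
  coordinates act as the identity on the \<open>\<real>\<close> factor. This yields the formula for \<open>d(e\<^sup>\<theta> \<alpha>)\<close>
  (\<open>symplectization_form_in_chart\<close>) and, with cylinders over slice charts, the submanifold property
  and the tangent spaces of \<open>\<real> \<times> Y\<close>.
\<close>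

section \<open>Smooth maps on open sets\<close>

lemma frechet_derivative_eq:
  assumes "(f has_derivative f') (at x)"
  shows "frechet_derivative f (at x) v = f' v"
  using frechet_derivative_at[OF assms] by simp

lemma smooth_on_has_derivative:
  assumes "smooth_on S f" "x \<in> S"
  shows "(f has_derivative frechet_derivative f (at x)) (at x)"
proof -
  have "times_differentiable_on (Suc 0) S f"
    using assms(1) unfolding smooth_on_def by blast
  then show ?thesis
    using assms(2) by (simp add: frechet_derivative_works)
qed

lemma smooth_on_directional_derivative:
  assumes "smooth_on S f"
  shows "smooth_on S (\<lambda>x. frechet_derivative f (at x) v)"
proof -
  have "times_differentiable_on (Suc n) S f" for n
    using assms unfolding smooth_on_def by blast
  then show ?thesis
    by (simp add: smooth_on_def)
qed

lemma smooth_on_imp_continuous_on: "smooth_on S f \<Longrightarrow> continuous_on S f"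
  unfolding smooth_on_def by (metis times_differentiable_on.simps(1))

text \<open>Iterated differentiability sees a function only near the points of \<open>S\<close>; this is what lets
  formulas that hold on an overlap of charts be differentiated there.\<close>

lemma times_differentiable_on_cong:
  assumes "times_differentiable_on n S f" "open S" "\<And>x. x \<in> S \<Longrightarrow> f x = g x"
  shows "times_differentiable_on n S g"
  using assms(1,3)
proof (induction n arbitrary: f g)
  case 0
  then show ?case
    using continuous_on_cong[of S S f g] by simp
next
  case (Suc n)
  have der: "(g has_derivative frechet_derivative f (at x)) (at x)" if "x \<in> S" for x
    using Suc.prems that assms(2)
    by (auto simp: frechet_derivative_works intro: has_derivative_transform_within_open)
  have "times_differentiable_on n S (\<lambda>x. frechet_derivative g (at x) v)" for v
  proof (rule Suc.IH)
    show "times_differentiable_on n S (\<lambda>x. frechet_derivative f (at x) v)"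
      using Suc.prems by simp
    show "frechet_derivative f (at x) v = frechet_derivative g (at x) v" if "x \<in> S" for x
      using frechet_derivative_eq[OF der[OF that]] by simp
  qed
  moreover have "\<forall>x\<in>S. g differentiable (at x)"
    using der by (auto simp: differentiable_def)
  ultimately show ?case by simp
qed

lemma smooth_on_cong:
  assumes "smooth_on S f" "open S" "\<And>x. x \<in> S \<Longrightarrow> f x = g x"
  shows "smooth_on S g"
  using assms times_differentiable_on_cong unfolding smooth_on_def by blast

text \<open>Precomposition with an affine map is the only kind of composition for which smoothness itself is
  needed: slice charts are straight, so the curves that realise tangent vectors are affine in them,
  and projections of products are linear. Here the chain rule produces no higher-order terms and a
  plain induction works.\<close>

lemma times_differentiable_on_compose_affine:
  fixes l :: "'a::euclidean_space \<Rightarrow> 'b::euclidean_space"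
  assumes "times_differentiable_on n S f" "open T" "linear l" "\<And>x. x \<in> T \<Longrightarrow> a + l x \<in> S"
  shows "times_differentiable_on n T (\<lambda>x. f (a + l x))"
  using assms(1)
proof (induction n arbitrary: f)
  case 0
  have "continuous_on T (\<lambda>x. a + l x)"
    using assms(3) by (intro continuous_intros linear_continuous_on) (simp add: linear_conv_bounded_linear)
  with 0 assms(4) show ?case
    by (auto intro: continuous_on_compose2)
next
  case (Suc n)
  have l: "((\<lambda>x. a + l x) has_derivative l) (at x)" for x
    using has_derivative_add[OF has_derivative_const
        bounded_linear_imp_has_derivative[OF assms(3)[unfolded linear_conv_bounded_linear]]]
    by simp
  have der: "((\<lambda>x. f (a + l x)) has_derivative (\<lambda>v. frechet_derivative f (at (a + l x)) (l v))) (at x)"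
    if "x \<in> T" for x
    using diff_chain_at[OF l, of f _ x] Suc.prems assms(4)[OF that]
    by (force simp: frechet_derivative_works o_def)
  have "times_differentiable_on n T (\<lambda>x. frechet_derivative (\<lambda>x. f (a + l x)) (at x) v)" for v
  proof (rule times_differentiable_on_cong)
    show "times_differentiable_on n T (\<lambda>x. frechet_derivative f (at (a + l x)) (l v))"
      using Suc.IH[of "\<lambda>y. frechet_derivative f (at y) (l v)"] Suc.prems by simp
    show "frechet_derivative f (at (a + l x)) (l v) = frechet_derivative (\<lambda>x. f (a + l x)) (at x) v"
      if "x \<in> T" for x
      by (rule frechet_derivative_eq[OF der[OF that], symmetric])
  qed (fact assms)
  moreover have "\<forall>x\<in>T. (\<lambda>x. f (a + l x)) differentiable (at x)"
    using der by (auto simp: differentiable_def)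
  ultimately show ?case by simp
qed

lemma smooth_on_compose_affine:
  fixes l :: "'a::euclidean_space \<Rightarrow> 'b::euclidean_space"
  assumes "smooth_on S f" "open T" "linear l" "\<And>x. x \<in> T \<Longrightarrow> a + l x \<in> S"
  shows "smooth_on T (\<lambda>x. f (a + l x))"
  using assms times_differentiable_on_compose_affine unfolding smooth_on_def by blast

lemma times_differentiable_on_linear_compose:
  fixes l :: "'b::euclidean_space \<Rightarrow> 'c::euclidean_space"
  assumes "times_differentiable_on n S f" "open S" "linear l"
  shows "times_differentiable_on n S (\<lambda>x. l (f x))"
  using assms(1)
proof (induction n arbitrary: f)
  case 0
  then show ?case
    using assms(3) by (auto intro: linear_continuous_on_compose)
next
  case (Suc n)
  have der: "((\<lambda>x. l (f x)) has_derivative (\<lambda>v. l (frechet_derivative f (at x) v))) (at x)"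
    if "x \<in> S" for x
    using Suc.prems that assms(3)
    by (auto simp: frechet_derivative_works linear_conv_bounded_linear
        intro: bounded_linear.has_derivative)
  have "times_differentiable_on n S (\<lambda>x. frechet_derivative (\<lambda>x. l (f x)) (at x) v)" for v
  proof (rule times_differentiable_on_cong)
    show "times_differentiable_on n S (\<lambda>x. l (frechet_derivative f (at x) v))"
      using Suc.IH Suc.prems by simp
    show "l (frechet_derivative f (at x) v) = frechet_derivative (\<lambda>x. l (f x)) (at x) v"
      if "x \<in> S" for x
      by (rule frechet_derivative_eq[OF der[OF that], symmetric])
  qed (fact assms)
  moreover have "\<forall>x\<in>S. (\<lambda>x. l (f x)) differentiable (at x)"
    using der by (auto simp: differentiable_def)
  ultimately show ?case by simp
qed

lemma smooth_on_linear_compose: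
  fixes l :: "'b::euclidean_space \<Rightarrow> 'c::euclidean_space"
  assumes "smooth_on S f" "open S" "linear l"
  shows "smooth_on S (\<lambda>x. l (f x))"
  using assms times_differentiable_on_linear_compose unfolding smooth_on_def by blast

lemma times_differentiable_on_Pair:
  assumes "times_differentiable_on n S f" "times_differentiable_on n S g" "open S"
  shows "times_differentiable_on n S (\<lambda>x. (f x, g x))"
  using assms(1,2)
proof (induction n arbitrary: f g)
  case 0
  then show ?case by (auto intro: continuous_on_Pair)
next
  case (Suc n)
  have der: "((\<lambda>x. (f x, g x)) has_derivative
      (\<lambda>v. (frechet_derivative f (at x) v, frechet_derivative g (at x) v))) (at x)"
    if "x \<in> S" for x
    using Suc.prems that by (auto simp: frechet_derivative_works intro: has_derivative_Pair)
  have "times_differentiable_on n S (\<lambda>x. frechet_derivative (\<lambda>x. (f x, g x)) (at x) v)" for v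
  proof (rule times_differentiable_on_cong)
    show "times_differentiable_on n S
        (\<lambda>x. (frechet_derivative f (at x) v, frechet_derivative g (at x) v))"
      using Suc.IH Suc.prems by simp
    show "(frechet_derivative f (at x) v, frechet_derivative g (at x) v)
        = frechet_derivative (\<lambda>x. (f x, g x)) (at x) v" if "x \<in> S" for x
      by (rule frechet_derivative_eq[OF der[OF that], symmetric])
  qed (fact assms)
  moreover have "\<forall>x\<in>S. (\<lambda>x. (f x, g x)) differentiable (at x)"
    using der by (auto simp: differentiable_def)
  ultimately show ?case by simp
qed

lemma smooth_on_Pair:
  assumes "smooth_on S f" "smooth_on S g" "open S"
  shows "smooth_on S (\<lambda>x. (f x, g x))"
  using assms times_differentiable_on_Pair unfolding smooth_on_def by blast

lemma smooth_on_const: "smooth_on S (\<lambda>x. c)"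
proof -
  have "times_differentiable_on n S (\<lambda>x. c)" for n
    by (induction n arbitrary: c) auto
  then show ?thesis by (simp add: smooth_on_def)
qed

lemma smooth_on_ident: "smooth_on S (\<lambda>x. x)"
  unfolding smooth_on_def
proof
  fix n show "times_differentiable_on n S (\<lambda>x. x)"
    using smooth_on_const[of S] unfolding smooth_on_def by (cases n) auto
qed

lemma smooth_on_affine:
  fixes l :: "'a::euclidean_space \<Rightarrow> 'b::euclidean_space"
  assumes "open S" "linear l"
  shows "smooth_on S (\<lambda>x. a + l x)"
  by (rule smooth_on_compose_affine[OF smooth_on_ident[of UNIV]]) (use assms in auto)

section \<open>Symmetry of second derivatives\<close>

lemma has_real_derivative_along_line:
  fixes f :: "'a::real_normed_vector \<Rightarrow> real"
  assumes "(f has_derivative f') (at (x + s *\<^sub>R u))"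
  shows "((\<lambda>s. f (x + s *\<^sub>R u)) has_real_derivative f' u) (at s)"
proof -
  have "((\<lambda>s. x + s *\<^sub>R u) has_vector_derivative u) (at s)"
    unfolding has_vector_derivative_def by (auto intro!: derivative_eq_intros)
  from vector_derivative_diff_chain_within[OF this has_derivative_at_withinI[OF assms]]
  show ?thesis
    by (simp add: o_def has_real_derivative_iff_has_vector_derivative)
qed

text \<open>Two applications of the mean value theorem, first to \<open>s \<mapsto> f (x + s u + t v) - f (x + s u)\<close> and
  then in the direction \<open>v\<close>. The left-hand side is symmetric in \<open>u\<close> and \<open>v\<close>.\<close>

lemma second_difference_mean_value:
  fixes f :: "'a::euclidean_space \<Rightarrow> real"
  assumes "smooth_on S f" "ball x r \<subseteq> S" "t > 0" "t * (norm u + norm v) < r"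
  shows "\<exists>y\<in>ball x r. f (x + t *\<^sub>R u + t *\<^sub>R v) - f (x + t *\<^sub>R u) - f (x + t *\<^sub>R v) + f x
           = t * t * frechet_derivative (\<lambda>y. frechet_derivative f (at y) u) (at y) v"
proof -
  have in_ball: "x + a *\<^sub>R u + b *\<^sub>R v \<in> ball x r" if "0 \<le> a" "a \<le> t" "0 \<le> b" "b \<le> t" for a b
  proof -
    have "norm (a *\<^sub>R u + b *\<^sub>R v) \<le> a * norm u + b * norm v"
      using that by (intro order_trans[OF norm_triangle_ineq]) simp
    also have "\<dots> \<le> t * norm u + t * norm v"
      using that by (intro add_mono mult_right_mono) auto
    also have "\<dots> < r" using assms(4) by (simp add: algebra_simps)
    finally show ?thesis
      unfolding mem_ball dist_commute[of x] by (simp add: dist_norm add.assoc)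
  qed
  let ?D = "\<lambda>y. frechet_derivative f (at y) u"
  let ?g = "\<lambda>s. f (x + t *\<^sub>R v + s *\<^sub>R u) - f (x + s *\<^sub>R u)"
  have "(?g has_real_derivative ?D (x + t *\<^sub>R v + s *\<^sub>R u) - ?D (x + s *\<^sub>R u)) (at s)"
    if "0 \<le> s" "s \<le> t" for s
    using that in_ball[of s t] in_ball[of s 0] assms
    by (intro DERIV_diff has_real_derivative_along_line smooth_on_has_derivative[OF assms(1)])
       (auto simp: algebra_simps)
  from MVT2[OF assms(3) this] obtain s where s: "0 < s" "s < t"
    and 1: "?g t - ?g 0 = t * (?D (x + t *\<^sub>R v + s *\<^sub>R u) - ?D (x + s *\<^sub>R u))"
    by auto
  have "((\<lambda>r. ?D (x + s *\<^sub>R u + r *\<^sub>R v)) has_real_derivative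
      frechet_derivative ?D (at (x + s *\<^sub>R u + r *\<^sub>R v)) v) (at r)" if "0 \<le> r" "r \<le> t" for r
    using that s in_ball[of s r] assms(2)
    by (intro has_real_derivative_along_line
        smooth_on_has_derivative[OF smooth_on_directional_derivative[OF assms(1)]]) auto
  from MVT2[OF assms(3) this] obtain b where b: "0 < b" "b < t"
    and 2: "?D (x + s *\<^sub>R u + t *\<^sub>R v) - ?D (x + s *\<^sub>R u)
        = t * frechet_derivative ?D (at (x + s *\<^sub>R u + b *\<^sub>R v)) v"
    by auto
  from 1 2 have "f (x + t *\<^sub>R u + t *\<^sub>R v) - f (x + t *\<^sub>R u) - f (x + t *\<^sub>R v) + f x
      = t * t * frechet_derivative ?D (at (x + s *\<^sub>R u + b *\<^sub>R v)) v"
    by (simp add: algebra_simps)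
  moreover have "x + s *\<^sub>R u + b *\<^sub>R v \<in> ball x r"
    using in_ball[of s b] s b by simp
  ultimately show ?thesis by blast
qed

text \<open>By the mean value identity for the second difference, the mixed derivatives in the two orders take
  a common value at points arbitrarily close to \<open>x\<close>; they agree at \<open>x\<close> by continuity.\<close>

lemma second_derivative_symmetric_real:
  fixes f :: "'a::euclidean_space \<Rightarrow> real"
  assumes "smooth_on S f" "open S" "x \<in> S"
  shows "frechet_derivative (\<lambda>y. frechet_derivative f (at y) u) (at x) v
       = frechet_derivative (\<lambda>y. frechet_derivative f (at y) v) (at x) u"
proof (rule ccontr)
  let ?H = "\<lambda>u v y. frechet_derivative (\<lambda>y. frechet_derivative f (at y) u) (at y) v"
  assume ne: "\<not> ?thesis"
  define \<epsilon> where "\<epsilon> = \<bar>?H u v x - ?H v u x\<bar> / 2"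
  have \<epsilon>: "\<epsilon> > 0" using ne by (simp add: \<epsilon>_def)
  have near: "\<forall>\<^sub>F y in nhds x. dist (?H u v y) (?H u v x) < \<epsilon>" for u v
  proof -
    have "continuous_on S (?H u v)"
      by (intro smooth_on_imp_continuous_on smooth_on_directional_derivative assms)
    then have "isCont (?H u v) x"
      using assms continuous_on_eq_continuous_at by blast
    then have "(?H u v \<longlongrightarrow> ?H u v x) (nhds x)"
      using tendsto_at_iff_tendsto_nhds[of "?H u v" x] unfolding isCont_def by blast
    then show ?thesis using \<epsilon> by (rule tendstoD)
  qed
  have "\<forall>\<^sub>F y in nhds x. y \<in> S \<and> dist (?H u v y) (?H u v x) < \<epsilon> \<and> dist (?H v u y) (?H v u x) < \<epsilon>"
    using near[of u v] near[of v u] eventually_nhds_in_open[OF assms(2,3)]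
    by eventually_elim auto
  then obtain r where r: "r > 0"
    and close: "\<And>y. y \<in> ball x r \<Longrightarrow>
      y \<in> S \<and> dist (?H u v y) (?H u v x) < \<epsilon> \<and> dist (?H v u y) (?H v u x) < \<epsilon>"
    unfolding eventually_nhds_metric by (auto simp: dist_commute)
  \<comment> \<open>The summand 1 keeps the quotient meaningful and the bound strict when \<open>u = v = 0\<close>.\<close>
  define t where "t = r / (norm u + norm v + 1)"
  have pos: "norm u + norm v + 1 > 0"
    by (smt (verit) norm_ge_zero)
  have t: "t > 0" "t * (norm u + norm v) < r"
    using r pos by (auto simp: t_def field_simps)
  have sub: "ball x r \<subseteq> S" using close by blast
  obtain y where y: "y \<in> ball x r"
    "f (x + t *\<^sub>R u + t *\<^sub>R v) - f (x + t *\<^sub>R u) - f (x + t *\<^sub>R v) + f x = t * t * ?H u v y"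
    using second_difference_mean_value[OF assms(1) sub t(1,2)] by blast
  obtain z where z: "z \<in> ball x r"
    "f (x + t *\<^sub>R v + t *\<^sub>R u) - f (x + t *\<^sub>R v) - f (x + t *\<^sub>R u) + f x = t * t * ?H v u z"
    using second_difference_mean_value[OF assms(1) sub t(1), of v u] t(2) by (auto simp: add.commute)
  have "t * t * ?H u v y = t * t * ?H v u z"
    using y(2) z(2) by (simp add: algebra_simps)
  then have "?H u v y = ?H v u z" using t(1) by simp
  moreover have "dist (?H u v y) (?H u v x) < \<epsilon>" "dist (?H v u z) (?H v u x) < \<epsilon>"
    using close y(1) z(1) by auto
  ultimately show False
    unfolding \<epsilon>_def dist_real_def by argo
qed

lemma frechet_derivative_inner_left:
  assumes "f differentiable (at x)"
  shows "frechet_derivative (\<lambda>x. f x \<bullet> b) (at x) v = frechet_derivative f (at x) v \<bullet> b"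
proof -
  have "((\<lambda>x. f x \<bullet> b) has_derivative (\<lambda>v. frechet_derivative f (at x) v \<bullet> b)) (at x)"
    using assms by (auto simp: frechet_derivative_works intro: has_derivative_inner_left)
  then show ?thesis by (rule frechet_derivative_eq)
qed

lemma second_derivative_symmetric:
  assumes "smooth_on S f" "open S" "x \<in> S"
  shows "frechet_derivative (\<lambda>y. frechet_derivative f (at y) u) (at x) v
       = frechet_derivative (\<lambda>y. frechet_derivative f (at y) v) (at x) u"
proof (rule euclidean_eqI)
  fix b :: 'b assume "b \<in> Basis"
  have diff: "g differentiable (at y)" if "smooth_on S g" "y \<in> S" for y and g :: "'a \<Rightarrow> 'b"
    using smooth_on_has_derivative[OF that] by (auto simp: differentiable_def)
  have comp: "frechet_derivative (\<lambda>y. frechet_derivative f (at y) u) (at x) v \<bullet> b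
      = frechet_derivative (\<lambda>y. frechet_derivative (\<lambda>z. f z \<bullet> b) (at y) u) (at x) v" for u v
  proof -
    have "frechet_derivative (\<lambda>y. frechet_derivative f (at y) u) (at x) v \<bullet> b
        = frechet_derivative (\<lambda>y. frechet_derivative f (at y) u \<bullet> b) (at x) v"
      by (rule frechet_derivative_inner_left[symmetric])
         (intro diff smooth_on_directional_derivative assms)
    also have "frechet_derivative (\<lambda>y. frechet_derivative f (at y) u \<bullet> b) (at x)
        = frechet_derivative (\<lambda>y. frechet_derivative (\<lambda>z. f z \<bullet> b) (at y) u) (at x)"
    proof (rule frechet_derivative_transform_within_open[OF _ assms(2,3)])
      show "(\<lambda>y. frechet_derivative f (at y) u \<bullet> b) differentiable (at x)"
        by (intro differentiable_inner diff smooth_on_directional_derivative assms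
            differentiable_const)
      show "frechet_derivative f (at y) u \<bullet> b = frechet_derivative (\<lambda>z. f z \<bullet> b) (at y) u"
        if "y \<in> S" for y
        by (rule frechet_derivative_inner_left[OF diff[OF assms(1) that], symmetric])
    qed
    finally show ?thesis .
  qed
  have "smooth_on S (\<lambda>z. f z \<bullet> b)"
    by (rule smooth_on_linear_compose[OF assms(1,2)])
       (simp add: linear_conv_bounded_linear bounded_linear_inner_left)
  from second_derivative_symmetric_real[OF this assms(2,3)]
  show "frechet_derivative (\<lambda>y. frechet_derivative f (at y) u) (at x) v \<bullet> b
      = frechet_derivative (\<lambda>y. frechet_derivative f (at y) v) (at x) u \<bullet> b"
    by (simp add: comp)
qed

section \<open>Charts and changes of coordinates\<close>

lemma chart_inv_map: "is_chart c \<Longrightarrow> p \<in> chart_dom c \<Longrightarrow> chart_inv c (chart_map c p) = p"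
  unfolding is_chart_def homeomorphism_def by blast

lemma chart_map_inv: "is_chart c \<Longrightarrow> x \<in> chart_image c \<Longrightarrow> chart_map c (chart_inv c x) = x"
  unfolding is_chart_def homeomorphism_def by blast

lemma chart_inv_in_dom: "is_chart c \<Longrightarrow> x \<in> chart_image c \<Longrightarrow> chart_inv c x \<in> chart_dom c"
  unfolding is_chart_def homeomorphism_def by blast

lemma open_chart_map_image:
  assumes "is_chart c" "open U"
  shows "open (chart_map c ` (chart_dom c \<inter> U))"
proof -
  have "chart_map c ` (chart_dom c \<inter> U) = chart_image c \<inter> chart_inv c -` U"
  proof (intro equalityI subsetI)
    fix x assume "x \<in> chart_image c \<inter> chart_inv c -` U"
    then have "x = chart_map c (chart_inv c x)" "chart_inv c x \<in> chart_dom c \<inter> U"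
      using assms(1) by (simp_all add: chart_map_inv chart_inv_in_dom)
    then show "x \<in> chart_map c ` (chart_dom c \<inter> U)" by (rule image_eqI)
  qed (use assms(1) in \<open>auto simp: chart_inv_map chart_image_def\<close>)
  moreover have "open (chart_image c \<inter> chart_inv c -` U)"
    using assms by (intro continuous_open_preimage) (auto simp: is_chart_def homeomorphism_def)
  ultimately show ?thesis by simp
qed

lemma transition_chart_map:
  "is_chart c \<Longrightarrow> p \<in> chart_dom c \<Longrightarrow> transition c d (chart_map c p) = chart_map d p"
  by (simp add: transition_def chart_inv_map)

abbreviation jacobian ::
    "('m, 'e::euclidean_space) chart \<Rightarrow> ('m, 'e) chart \<Rightarrow> 'm \<Rightarrow> 'e \<Rightarrow> 'e" where
  "jacobian c d p \<equiv> frechet_derivative (transition c d) (at (chart_map c p))"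

text \<open>The charts of the maximal atlas generated by \<open>A\<close>. Slice charts are of this kind without having to
  belong to \<open>A\<close>.\<close>

definition smooth_chart ::
    "('m::topological_space, 'e::euclidean_space) chart set \<Rightarrow> ('m, 'e) chart \<Rightarrow> bool"
  where "smooth_chart A c \<longleftrightarrow> is_chart c \<and> (\<forall>d\<in>A. compatible c d)"

lemma compatible_sym: "compatible c d \<Longrightarrow> compatible d c"
  by (auto simp: compatible_def Int_commute)

lemma has_derivative_jacobian:
  assumes "compatible c d" "p \<in> chart_dom c" "p \<in> chart_dom d"
  shows "(transition c d has_derivative jacobian c d p) (at (chart_map c p))"
  using assms by (intro smooth_on_has_derivative) (auto simp: compatible_def)

lemma linear_jacobian:
  assumes "compatible c d" "p \<in> chart_dom c" "p \<in> chart_dom d"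
  shows "linear (jacobian c d p)"
  using has_derivative_jacobian[OF assms] has_derivative_linear by blast

lemma jacobian_compose:
  assumes "is_chart b" "is_chart c" "compatible b c" "compatible c d"
    and "p \<in> chart_dom b" "p \<in> chart_dom c" "p \<in> chart_dom d"
  shows "jacobian c d p (jacobian b c p w) = jacobian b d p w"
proof -
  have "(transition c d \<circ> transition b c has_derivative jacobian c d p \<circ> jacobian b c p)
      (at (chart_map b p))"
    using diff_chain_at[OF has_derivative_jacobian, of b c p] has_derivative_jacobian[of c d p] assms
    by (simp add: transition_chart_map)
  then have "(transition b d has_derivative jacobian c d p \<circ> jacobian b c p) (at (chart_map b p))"
  proof (rule has_derivative_transform_within_open)
    show "open (chart_map b ` (chart_dom b \<inter> chart_dom c))"
      using assms by (intro open_chart_map_image) (auto simp: is_chart_def)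
  qed (use assms in \<open>auto simp: transition_chart_map\<close>)
  from frechet_derivative_eq[OF this] show ?thesis by simp
qed

lemma jacobian_self:
  assumes "is_chart c" "p \<in> chart_dom c"
  shows "jacobian c c p w = w"
proof -
  have "(transition c c has_derivative (\<lambda>w. w)) (at (chart_map c p))"
    by (rule has_derivative_transform_within_open[OF has_derivative_ident, of "chart_image c"])
       (use assms in \<open>auto simp: transition_def chart_map_inv is_chart_def chart_image_def\<close>)
  then show ?thesis by (rule frechet_derivative_eq)
qed

lemma smooth_chart_coord_tvec_in_tangent_space:
  assumes "smooth_atlas A" "smooth_chart A c" "p \<in> chart_dom c"
  shows "coord_tvec A c p w \<in> tangent_space A p"
proof -
  have "jacobian d e p (jacobian c d p w) = jacobian c e p w"
    if "d \<in> charts_at A p" "e \<in> charts_at A p" for d e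
    using assms that unfolding charts_at_def smooth_chart_def smooth_atlas_def
    by (intro jacobian_compose) blast+
  then show ?thesis by (simp add: tangent_space_def coord_tvec_def)
qed

lemma coord_tvec_at_chart:
  "smooth_chart A c \<Longrightarrow> c \<in> charts_at A p \<Longrightarrow> coord_tvec A c p w c = w"
  by (auto simp: coord_tvec_def charts_at_def jacobian_self smooth_chart_def)

lemma tangent_space_eq_coord_tvec:
  assumes "v \<in> tangent_space A p" "c \<in> charts_at A p"
  shows "v = coord_tvec A c p (v c)"
proof
  fix d
  show "v d = coord_tvec A c p (v c) d"
  proof (cases "d \<in> charts_at A p")
    case True
    then have "v d = jacobian c d p (v c)"
      using assms unfolding tangent_space_def by blast
    then show ?thesis
      using True by (simp only: coord_tvec_def if_True)
  next
    case False
    then have "v d = 0"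
      using assms unfolding tangent_space_def by blast
    with False show ?thesis by (simp add: coord_tvec_def)
  qed
qed

lemma coord_tvec_change_chart:
  assumes "smooth_atlas A" "smooth_chart A b" "c \<in> charts_at A p" "p \<in> chart_dom b"
  shows "coord_tvec A c p (jacobian b c p w) = coord_tvec A b p w"
proof -
  have "jacobian c d p (jacobian b c p w) = jacobian b d p w" if "d \<in> charts_at A p" for d
    using assms that unfolding charts_at_def smooth_chart_def smooth_atlas_def
    by (intro jacobian_compose) blast+
  then show ?thesis by (simp add: coord_tvec_def fun_eq_iff)
qed

lemma chart_at_in_charts_at:
  assumes "smooth_atlas A"
  shows "chart_at A p \<in> charts_at A p"
proof -
  have "p \<in> (\<Union>c\<in>A. chart_dom c)"
    using assms by (simp add: smooth_atlas_def)
  then have "\<exists>c. c \<in> charts_at A p"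
    by (auto simp: charts_at_def)
  then show ?thesis unfolding chart_at_def by (rule someI_ex)
qed

section \<open>Tangent spaces of submanifolds\<close>

lemma eventually_in_chart_dom:
  assumes "is_chart c" "isCont \<gamma> t" "\<gamma> t \<in> chart_dom c"
  shows "\<forall>\<^sub>F s in nhds t. \<gamma> s \<in> chart_dom c"
proof -
  have "(\<gamma> \<longlongrightarrow> \<gamma> t) (nhds t)"
    using assms(2) tendsto_at_iff_tendsto_nhds[of \<gamma> t] by (simp add: isCont_def)
  then show ?thesis
    using assms by (intro topological_tendstoD) (auto simp: is_chart_def)
qed

lemma has_vector_derivative_change_chart:
  assumes "is_chart c" "compatible c d" "isCont \<gamma> t" "\<gamma> t \<in> chart_dom c" "\<gamma> t \<in> chart_dom d"
    and der: "(chart_map c \<circ> \<gamma> has_vector_derivative w) (at t)"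
  shows "(chart_map d \<circ> \<gamma> has_vector_derivative jacobian c d (\<gamma> t) w) (at t)"
proof -
  let ?f = "transition c d \<circ> (chart_map c \<circ> \<gamma>)"
  have *: "(?f has_vector_derivative jacobian c d (\<gamma> t) w) (at t)"
    using has_derivative_at_withinI[OF has_derivative_jacobian[OF assms(2,4,5)]]
    by (intro vector_derivative_diff_chain_within[OF der]) simp
  have "\<forall>\<^sub>F s in nhds t. s \<in> UNIV \<longrightarrow> ?f s = (chart_map d \<circ> \<gamma>) s"
    using eventually_in_chart_dom[OF assms(1,3,4)]
    by eventually_elim (simp add: transition_chart_map[OF assms(1)])
  moreover have "?f t = (chart_map d \<circ> \<gamma>) t"
    using assms(4) by (simp add: transition_chart_map[OF assms(1)])
  ultimately have "(?f has_vector_derivative jacobian c d (\<gamma> t) w) (at t) \<longleftrightarrow>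
      (chart_map d \<circ> \<gamma> has_vector_derivative jacobian c d (\<gamma> t) w) (at t)"
    by (rule has_vector_derivative_cong_ev)
  with * show ?thesis by (rule iffD1[rotated])
qed

text \<open>The component of \<open>f\<close> orthogonal to \<open>S\<close> vanishes near \<open>t\<close>, and so does its derivative.\<close>

lemma has_vector_derivative_in_subspace:
  fixes f :: "real \<Rightarrow> 'a::euclidean_space"
  assumes "(f has_vector_derivative w) (at t)" "subspace S" "\<forall>\<^sub>F s in nhds t. f s \<in> S"
  shows "w \<in> S"
proof -
  obtain y z where y: "y \<in> span S" and z: "\<And>x. x \<in> span S \<Longrightarrow> orthogonal z x" and w: "w = y + z"
    using orthogonal_subspace_decomp_exists by blast
  have "((\<lambda>s. z \<bullet> f s) has_vector_derivative z \<bullet> w) (at t)"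
    by (rule bounded_linear.has_vector_derivative[OF bounded_linear_inner_right assms(1)])
  moreover have "\<forall>\<^sub>F s in nhds t. s \<in> UNIV \<longrightarrow> z \<bullet> f s = 0"
    using assms(3) by eventually_elim (use z span_base in \<open>auto simp: orthogonal_def\<close>)
  ultimately have "((\<lambda>s. 0) has_vector_derivative z \<bullet> w) (at t)"
    using has_vector_derivative_cong_ev[of UNIV "\<lambda>s. z \<bullet> f s" "\<lambda>s. 0" t "z \<bullet> w"]
      eventually_nhds_x_imp_x by blast
  then have "z \<bullet> w = 0"
    using vector_derivative_unique_at has_vector_derivative_const by blast
  then have "z = 0"
    using z[OF y] by (simp add: w orthogonal_def inner_add_right)
  then show ?thesis
    using y span_minimal[OF subset_refl assms(2)] by (auto simp: w)
qed

text \<open>In a slice chart \<open>Y\<close> is the flat piece \<open>S\<close>. A curve in \<open>Y\<close> has its coordinate velocity in \<open>S\<close>, and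
  every \<open>\<sigma> \<in> S\<close> is the velocity of the straight line in direction \<open>\<sigma>\<close>. In particular the
  velocities of curves in \<open>Y\<close> form a vector space, which the definition does not make evident.\<close>

lemma sub_tangent_space_in_slice_chart:
  assumes A: "smooth_atlas A" and s: "smooth_chart A s"
    and S: "subspace S" and slice: "chart_map s ` (chart_dom s \<inter> Y) = chart_image s \<inter> S"
    and p: "p \<in> Y" "p \<in> chart_dom s"
  shows "sub_tangent_space A Y p = coord_tvec A s p ` S"
proof (intro equalityI subsetI)
  fix v assume "v \<in> sub_tangent_space A Y p"
  then obtain \<gamma> \<epsilon> where v: "v = velocity A \<gamma> 0" and \<gamma>: "\<gamma> 0 = p" "\<epsilon> > 0"
    "smooth_curve A {-\<epsilon><..<\<epsilon>} \<gamma>" "\<gamma> ` {-\<epsilon><..<\<epsilon>} \<subseteq> Y"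
    unfolding sub_tangent_space_def by blast
  let ?I = "{-\<epsilon><..<\<epsilon>}"
  have cont: "continuous_on ?I \<gamma>" using \<gamma> by (simp add: smooth_curve_def)
  then have isCont: "isCont \<gamma> 0"
    using \<gamma>(2) continuous_on_eq_continuous_at[of ?I \<gamma>] by auto
  \<comment> \<open>Smoothness of \<open>\<gamma>\<close> is only given in the charts of \<open>A\<close>, so its
    coordinate velocity in \<open>s\<close> is obtained through one of them.\<close>
  define d where "d = chart_at A p"
  have d: "d \<in> A" "p \<in> chart_dom d"
    using chart_at_in_charts_at[OF A, of p] by (auto simp: d_def charts_at_def)
  have d': "is_chart d" "compatible d s" "is_chart s"
    using d A s by (auto simp: smooth_atlas_def smooth_chart_def intro: compatible_sym)
  have "smooth_on (?I \<inter> \<gamma> -` chart_dom d) (chart_map d \<circ> \<gamma>)"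
    using \<gamma> d by (simp add: smooth_curve_def)
  from smooth_on_has_derivative[OF this, of 0]
  have "(chart_map d \<circ> \<gamma>) differentiable (at 0)"
    using \<gamma> d by (auto simp: differentiable_def)
  then obtain w where "(chart_map d \<circ> \<gamma> has_vector_derivative w) (at 0)"
    using vector_derivative_works by blast
  then obtain \<sigma> where \<sigma>: "(chart_map s \<circ> \<gamma> has_vector_derivative \<sigma>) (at 0)"
    using has_vector_derivative_change_chart[OF d'(1,2) isCont] \<gamma>(1) d(2) p(2) by blast
  have "\<forall>\<^sub>F t in nhds 0. \<gamma> t \<in> chart_dom s"
    using isCont p \<gamma>(1) d'(3) by (intro eventually_in_chart_dom) auto
  moreover have "\<forall>\<^sub>F t in nhds 0. t \<in> ?I"
    using \<gamma>(2) by (intro eventually_nhds_in_open) auto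
  ultimately have "\<forall>\<^sub>F t in nhds 0. (chart_map s \<circ> \<gamma>) t \<in> S"
  proof eventually_elim
    case (elim t)
    then have "\<gamma> t \<in> Y" using \<gamma>(4) by blast
    with elim(1) have "chart_map s (\<gamma> t) \<in> chart_image s \<inter> S"
      unfolding slice[symmetric] by blast
    then show ?case by simp
  qed
  then have "\<sigma> \<in> S"
    by (rule has_vector_derivative_in_subspace[OF \<sigma> S])
  moreover have "v = coord_tvec A s p \<sigma>"
  proof
    fix c
    show "v c = coord_tvec A s p \<sigma> c"
    proof (cases "c \<in> charts_at A p")
      case True
      have "(chart_map c \<circ> \<gamma> has_vector_derivative jacobian s c p \<sigma>) (at 0)"
        using has_vector_derivative_change_chart[OF d'(3) _ isCont _ _ \<sigma>, of c] True p s \<gamma>(1)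
        by (auto simp: charts_at_def smooth_chart_def)
      then show ?thesis
        using True \<gamma>(1) by (simp add: v velocity_def coord_tvec_def vector_derivative_at)
    qed (simp add: v velocity_def coord_tvec_def \<gamma>(1))
  qed
  ultimately show "v \<in> coord_tvec A s p ` S" by blast
next
  fix v assume "v \<in> coord_tvec A s p ` S"
  then obtain \<sigma> where \<sigma>: "\<sigma> \<in> S" "v = coord_tvec A s p \<sigma>" by blast
  have s': "is_chart s" using s by (simp add: smooth_chart_def)
  let ?x = "chart_map s p"
  have x: "?x \<in> chart_image s \<inter> S" using slice p by blast
  have "\<forall>\<^sub>F t in nhds 0. ?x + t *\<^sub>R \<sigma> \<in> chart_image s"
  proof -
    have "((\<lambda>t. ?x + t *\<^sub>R \<sigma>) \<longlongrightarrow> ?x + 0 *\<^sub>R \<sigma>) (nhds 0)"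
      by (intro tendsto_intros filterlim_ident)
    then show ?thesis
      using x s' by (intro topological_tendstoD) (auto simp: is_chart_def)
  qed
  then obtain \<epsilon> where \<epsilon>: "\<epsilon> > 0" "\<And>t. \<bar>t\<bar> < \<epsilon> \<Longrightarrow> ?x + t *\<^sub>R \<sigma> \<in> chart_image s"
    unfolding eventually_nhds_metric by (auto simp: dist_real_def)
  let ?I = "{-\<epsilon><..<\<epsilon>}"
  define \<gamma> where "\<gamma> t = chart_inv s (?x + t *\<^sub>R \<sigma>)" for t
  have line: "?x + t *\<^sub>R \<sigma> \<in> chart_image s" if "t \<in> ?I" for t
    using \<epsilon>(2)[of t] that by auto
  have s\<gamma>: "chart_map s (\<gamma> t) = ?x + t *\<^sub>R \<sigma>" "\<gamma> t \<in> chart_dom s" if "t \<in> ?I" for t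
    using line[OF that] s' by (auto simp: \<gamma>_def chart_map_inv chart_inv_in_dom)
  have \<gamma>0: "\<gamma> 0 = p" using s' p by (simp add: \<gamma>_def chart_inv_map)
  have "\<gamma> t \<in> Y" if "t \<in> ?I" for t
  proof -
    have "?x + t *\<^sub>R \<sigma> \<in> chart_image s \<inter> S"
      using line[OF that] x \<sigma> S by (auto intro: subspace_add subspace_scale)
    then obtain q where "q \<in> chart_dom s" "q \<in> Y" "?x + t *\<^sub>R \<sigma> = chart_map s q"
      unfolding slice[symmetric] by blast
    then show ?thesis using s' by (simp add: \<gamma>_def chart_inv_map)
  qed
  moreover have cont: "continuous_on ?I \<gamma>"
  proof -
    have "continuous_on (chart_image s) (chart_inv s)"
      using s' by (auto simp: is_chart_def homeomorphism_def)
    then show ?thesis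
      unfolding \<gamma>_def
      by (rule continuous_on_compose2) (use line in \<open>auto intro!: continuous_intros\<close>)
  qed
  moreover have "smooth_on (?I \<inter> \<gamma> -` chart_dom c) (chart_map c \<circ> \<gamma>)" if c: "c \<in> A" for c
  proof -
    have cs: "compatible s c" "is_chart c"
      using c s A by (auto simp: smooth_chart_def smooth_atlas_def)
    have "chart_map c \<circ> \<gamma> = (\<lambda>t. transition s c (?x + t *\<^sub>R \<sigma>))"
      by (auto simp: \<gamma>_def transition_def)
    moreover have "smooth_on (?I \<inter> \<gamma> -` chart_dom c) (\<lambda>t. transition s c (?x + t *\<^sub>R \<sigma>))"
    proof (rule smooth_on_compose_affine)
      show "smooth_on (chart_map s ` (chart_dom s \<inter> chart_dom c)) (transition s c)"
        using cs by (simp add: compatible_def)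
      show "open (?I \<inter> \<gamma> -` chart_dom c)"
        using cont cs by (intro continuous_open_preimage) (auto simp: is_chart_def)
      show "linear (\<lambda>t. t *\<^sub>R \<sigma>)" by (simp add: linear_scaleR_left)
      show "?x + t *\<^sub>R \<sigma> \<in> chart_map s ` (chart_dom s \<inter> chart_dom c)"
        if "t \<in> ?I \<inter> \<gamma> -` chart_dom c" for t
        using that s\<gamma>[of t] by (intro image_eqI[of _ _ "\<gamma> t"]) auto
    qed
    ultimately show ?thesis by simp
  qed
  moreover have "v = velocity A \<gamma> 0"
  proof
    fix c
    show "v c = velocity A \<gamma> 0 c"
    proof (cases "c \<in> charts_at A p")
      case True
      have "((\<lambda>t. ?x + t *\<^sub>R \<sigma>) has_vector_derivative \<sigma>) (at 0)"
        unfolding has_vector_derivative_def by (auto intro!: derivative_eq_intros)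
      moreover have "(transition s c has_derivative jacobian s c p) (at ?x)"
        using True s p by (intro has_derivative_jacobian) (auto simp: charts_at_def smooth_chart_def)
      ultimately have "(transition s c \<circ> (\<lambda>t. ?x + t *\<^sub>R \<sigma>) has_vector_derivative jacobian s c p \<sigma>) (at 0)"
        by (intro vector_derivative_diff_chain_within) (simp_all add: has_derivative_at_withinI)
      moreover have "transition s c \<circ> (\<lambda>t. ?x + t *\<^sub>R \<sigma>) = chart_map c \<circ> \<gamma>"
        by (auto simp: \<gamma>_def transition_def)
      ultimately show ?thesis
        using True \<gamma>0 by (simp add: \<sigma>(2) velocity_def coord_tvec_def vector_derivative_at)
    qed (simp add: \<sigma> velocity_def coord_tvec_def \<gamma>0)
  qed
  ultimately show "v \<in> sub_tangent_space A Y p"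
    unfolding sub_tangent_space_def smooth_curve_def using \<gamma>0 \<epsilon>(1) by blast
qed

text \<open>The tangent space of \<open>Y\<close> read in an arbitrary chart \<open>c\<close> of the atlas: it is the fixed linear
  subspace \<open>jacobian s c p ` S\<close> of the coordinate space.\<close>

lemma mem_sub_tangent_space_iff:
  assumes "smooth_atlas A" "smooth_chart A s"
    and "subspace S" "chart_map s ` (chart_dom s \<inter> Y) = chart_image s \<inter> S"
    and "p \<in> Y" "p \<in> chart_dom s" "c \<in> charts_at A p"
  shows "v \<in> sub_tangent_space A Y p \<longleftrightarrow> v \<in> tangent_space A p \<and> v c \<in> jacobian s c p ` S"
proof -
  have *: "sub_tangent_space A Y p = coord_tvec A s p ` S"
    by (rule sub_tangent_space_in_slice_chart) (use assms in auto)
  show ?thesis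
  proof
    assume "v \<in> sub_tangent_space A Y p"
    then obtain \<sigma> where "\<sigma> \<in> S" "v = coord_tvec A s p \<sigma>" using * by blast
    moreover have "coord_tvec A s p \<sigma> c = jacobian s c p \<sigma>"
      using assms by (simp add: coord_tvec_def)
    ultimately show "v \<in> tangent_space A p \<and> v c \<in> jacobian s c p ` S"
      using smooth_chart_coord_tvec_in_tangent_space[OF assms(1,2,6)] by simp
  next
    assume "v \<in> tangent_space A p \<and> v c \<in> jacobian s c p ` S"
    then obtain \<sigma> where "\<sigma> \<in> S" "v c = jacobian s c p \<sigma>" "v \<in> tangent_space A p"
      by blast
    moreover from this have "v = coord_tvec A c p (jacobian s c p \<sigma>)"
      using tangent_space_eq_coord_tvec assms(7) by metis
    ultimately show "v \<in> sub_tangent_space A Y p"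
      unfolding * by (simp add: coord_tvec_change_chart[OF assms(1,2,7,6)])
  qed
qed

section \<open>The exterior derivative in charts\<close>

text \<open>The product rule for \<open>a (\<tau> y) (J y)\<close>, where \<open>a z\<close> is linear. Expanding the second argument in the
  standard basis turns it into a finite sum of products of real functions.\<close>

lemma has_derivative_family_of_linear_maps:
  fixes a :: "'e::euclidean_space \<Rightarrow> 'e \<Rightarrow> real" and \<tau> J :: "'d::euclidean_space \<Rightarrow> 'e"
  assumes "open T" "\<And>z. z \<in> T \<Longrightarrow> linear (a z)" "\<And>w. (\<lambda>z. a z w) differentiable (at (\<tau> x))"
    and "\<tau> x \<in> T"
    and \<tau>: "(\<tau> has_derivative \<tau>') (at x)" and J: "(J has_derivative J') (at x)"
  shows "((\<lambda>y. a (\<tau> y) (J y)) has_derivative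
      (\<lambda>u. frechet_derivative (\<lambda>z. a z (J x)) (at (\<tau> x)) (\<tau>' u) + a (\<tau> x) (J' u))) (at x)"
proof -
  let ?D = "\<lambda>w. frechet_derivative (\<lambda>z. a z w) (at (\<tau> x))"
  have expand: "a z w = (\<Sum>b\<in>Basis. (w \<bullet> b) * a z b)" if "z \<in> T" for z w
  proof -
    interpret linear "a z" by (rule assms(2)[OF that])
    have "a z w = a z (\<Sum>b\<in>Basis. (w \<bullet> b) *\<^sub>R b)" by (simp add: euclidean_representation)
    also have "\<dots> = (\<Sum>b\<in>Basis. (w \<bullet> b) * a z b)" by (simp add: sum scale)
    finally show ?thesis .
  qed
  have D: "((\<lambda>z. a z w) has_derivative ?D w) (at (\<tau> x))" for w
    using assms(3) by (simp add: frechet_derivative_works)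
  have "((\<lambda>z. \<Sum>b\<in>Basis. (w \<bullet> b) * a z b) has_derivative (\<lambda>v. \<Sum>b\<in>Basis. (w \<bullet> b) * ?D b v)) (at (\<tau> x))" for w
    by (intro has_derivative_sum has_derivative_mult_right D)
  then have "((\<lambda>z. a z w) has_derivative (\<lambda>v. \<Sum>b\<in>Basis. (w \<bullet> b) * ?D b v)) (at (\<tau> x))" for w
    by (rule has_derivative_transform_within_open[OF _ assms(1,4)]) (rule expand[symmetric])
  then have D_expand: "?D w v = (\<Sum>b\<in>Basis. (w \<bullet> b) * ?D b v)" for w v
    by (rule frechet_derivative_eq)
  have comp: "((\<lambda>y. a (\<tau> y) b) has_derivative (\<lambda>u. ?D b (\<tau>' u))) (at x)" for b
    using diff_chain_at[OF \<tau> D] by (simp add: o_def)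
  have "((\<lambda>y. \<Sum>b\<in>Basis. (J y \<bullet> b) * a (\<tau> y) b) has_derivative
      (\<lambda>u. \<Sum>b\<in>Basis. (J x \<bullet> b) * ?D b (\<tau>' u) + (J' u \<bullet> b) * a (\<tau> x) b)) (at x)"
    by (intro has_derivative_sum has_derivative_mult has_derivative_inner_left J comp)
  moreover have "(\<Sum>b\<in>Basis. (J x \<bullet> b) * ?D b (\<tau>' u) + (J' u \<bullet> b) * a (\<tau> x) b)
      = ?D (J x) (\<tau>' u) + a (\<tau> x) (J' u)" for u
    by (simp only: sum.distrib flip: D_expand expand[OF assms(4)])
  ultimately have "((\<lambda>y. \<Sum>b\<in>Basis. (J y \<bullet> b) * a (\<tau> y) b) has_derivative
      (\<lambda>u. ?D (J x) (\<tau>' u) + a (\<tau> x) (J' u))) (at x)"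
    by simp
  moreover have "\<forall>\<^sub>F y in at x. (\<Sum>b\<in>Basis. (J y \<bullet> b) * a (\<tau> y) b) = a (\<tau> y) (J y)"
  proof -
    have "(\<tau> \<longlongrightarrow> \<tau> x) (at x)"
      using has_derivative_continuous[OF \<tau>] by (simp add: isCont_def)
    then have "\<forall>\<^sub>F y in at x. \<tau> y \<in> T"
      using assms(1,4) by (rule topological_tendstoD)
    then show ?thesis by eventually_elim (rule expand[symmetric])
  qed
  ultimately show ?thesis
    by (rule has_derivative_transform_eventually) (rule expand[OF assms(4), symmetric], rule UNIV_I)
qed

text \<open>The coordinate expression behind \<open>ext_deriv\<close>, for a chart that is named rather than chosen.\<close>

definition coord_ext_deriv ::
    "('m, 'e::euclidean_space) chart set \<Rightarrow> ('m, 'e) one_form \<Rightarrow> ('m, 'e) chart \<Rightarrow> 'e \<Rightarrow> 'e \<Rightarrow> 'e \<Rightarrow> real"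
  where "coord_ext_deriv A \<alpha> c x u v =
     frechet_derivative (\<lambda>y. local_form A \<alpha> c y v) (at x) u
   - frechet_derivative (\<lambda>y. local_form A \<alpha> c y u) (at x) v"

lemma local_form_differentiable:
  assumes "is_one_form A \<alpha>" "c \<in> A" "x \<in> chart_image c"
  shows "(\<lambda>y. local_form A \<alpha> c y w) differentiable (at x)"
proof -
  have "smooth_on (chart_image c) (\<lambda>x. local_form A \<alpha> c x w)"
    using assms(1,2) by (simp add: is_one_form_def)
  from smooth_on_has_derivative[OF this assms(3)] show ?thesis
    by (auto simp: differentiable_def)
qed

lemma linear_coord_ext_deriv_right:
  assumes "is_one_form A \<alpha>" "c \<in> A" "is_chart c" "x \<in> chart_image c"
  shows "linear (coord_ext_deriv A \<alpha> c x u)"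
proof -
  let ?a = "local_form A \<alpha> c"
  have a: "linear (?a y)" if "y \<in> chart_image c" for y
    using assms that by (simp add: is_one_form_def)
  have "((\<lambda>y. ?a y v) has_derivative
      (\<lambda>u. frechet_derivative (\<lambda>y. ?a y v) (at x) u)) (at x)" for v
    using local_form_differentiable[OF assms(1,2,4)] by (simp add: frechet_derivative_works)
  note D = this
  have "linear (\<lambda>v. frechet_derivative (\<lambda>y. ?a y v) (at x) u)"
  proof (rule linearI)
    fix v w
    have "((\<lambda>y. ?a y (v + w)) has_derivative (\<lambda>u. frechet_derivative (\<lambda>y. ?a y v) (at x) u
        + frechet_derivative (\<lambda>y. ?a y w) (at x) u)) (at x)"
      by (rule has_derivative_transform_within_open[OF has_derivative_add[OF D D], of "chart_image c"])
         (use assms a in \<open>auto simp: is_chart_def linear_add\<close>)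
    then show "frechet_derivative (\<lambda>y. ?a y (v + w)) (at x) u
        = frechet_derivative (\<lambda>y. ?a y v) (at x) u + frechet_derivative (\<lambda>y. ?a y w) (at x) u"
      by (rule frechet_derivative_eq)
  next
    fix r v
    have "((\<lambda>y. ?a y (r *\<^sub>R v)) has_derivative
        (\<lambda>u. r *\<^sub>R frechet_derivative (\<lambda>y. ?a y v) (at x) u)) (at x)"
      by (rule has_derivative_transform_within_open[OF has_derivative_scaleR_right[OF D], of "chart_image c"])
         (use assms a in \<open>auto simp: is_chart_def linear_cmul\<close>)
    then show "frechet_derivative (\<lambda>y. ?a y (r *\<^sub>R v)) (at x) u
        = r *\<^sub>R frechet_derivative (\<lambda>y. ?a y v) (at x) u"
      by (rule frechet_derivative_eq)
  qed
  moreover have "linear (frechet_derivative (\<lambda>y. ?a y u) (at x))"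
    by (rule linear_frechet_derivative) (rule local_form_differentiable[OF assms(1,2,4)])
  ultimately show ?thesis
    unfolding coord_ext_deriv_def by (rule linear_compose_sub)
qed

lemma local_form_change_chart:
  assumes "smooth_atlas A" "c \<in> charts_at A p" "d \<in> charts_at A p"
  shows "local_form A \<alpha> c (chart_map c p) w = local_form A \<alpha> d (chart_map d p) (jacobian c d p w)"
proof -
  have "is_chart c" "is_chart d" "p \<in> chart_dom c" "p \<in> chart_dom d" "smooth_chart A c"
    using assms by (auto simp: charts_at_def smooth_atlas_def smooth_chart_def)
  then show ?thesis
    using assms by (simp add: local_form_def chart_inv_map coord_tvec_change_chart)
qed

text \<open>The exterior derivative commutes with changes of coordinates. The transition map contributes a
  term with its second derivative to each half of the formula, and these cancel because second
  derivatives are symmetric.\<close>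

lemma coord_ext_deriv_change_chart:
  assumes A: "smooth_atlas A" and \<alpha>: "is_one_form A \<alpha>"
    and c: "c \<in> charts_at A p" and d: "d \<in> charts_at A p"
  shows "coord_ext_deriv A \<alpha> c (chart_map c p) u v
       = coord_ext_deriv A \<alpha> d (chart_map d p) (jacobian c d p u) (jacobian c d p v)"
proof -
  have cd: "c \<in> A" "d \<in> A" "p \<in> chart_dom c" "p \<in> chart_dom d" "is_chart c" "is_chart d" "compatible c d"
    using A c d by (auto simp: charts_at_def smooth_atlas_def)
  let ?x = "chart_map c p" and ?\<tau> = "transition c d" and ?U = "chart_map c ` (chart_dom c \<inter> chart_dom d)"
  let ?b = "local_form A \<alpha> d"
  have \<tau>: "smooth_on ?U ?\<tau>" using cd by (simp add: compatible_def)
  have U: "open ?U" "?x \<in> ?U"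
    using cd by (auto intro: open_chart_map_image simp: is_chart_def)
  have \<tau>x: "?\<tau> ?x = chart_map d p" "chart_map d p \<in> chart_image d"
    using cd by (auto simp: transition_chart_map chart_image_def)
  have key: "frechet_derivative (\<lambda>y. local_form A \<alpha> c y w) (at ?x) u
      = frechet_derivative (\<lambda>z. ?b z (jacobian c d p w)) (at (chart_map d p)) (jacobian c d p u)
      + ?b (chart_map d p) (frechet_derivative (\<lambda>y. frechet_derivative ?\<tau> (at y) w) (at ?x) u)"
    for u w
  proof -
    have "((\<lambda>y. ?b (?\<tau> y) (frechet_derivative ?\<tau> (at y) w)) has_derivative
      (\<lambda>u. frechet_derivative (\<lambda>z. ?b z (jacobian c d p w)) (at (?\<tau> ?x)) (jacobian c d p u)
         + ?b (?\<tau> ?x) (frechet_derivative (\<lambda>y. frechet_derivative ?\<tau> (at y) w) (at ?x) u))) (at ?x)"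
    proof (rule has_derivative_family_of_linear_maps)
      show "open (chart_image d)" using cd by (simp add: is_chart_def)
      show "linear (?b z)" if "z \<in> chart_image d" for z
        using \<alpha> cd that by (simp add: is_one_form_def)
      show "?\<tau> ?x \<in> chart_image d" by (simp add: \<tau>x)
      show "(\<lambda>z. ?b z w) differentiable (at (?\<tau> ?x))" for w
        using \<tau>x by (auto intro: local_form_differentiable[OF \<alpha> cd(2)])
      show "(?\<tau> has_derivative jacobian c d p) (at ?x)"
        by (rule smooth_on_has_derivative[OF \<tau> U(2)])
      show "((\<lambda>y. frechet_derivative ?\<tau> (at y) w) has_derivative
          frechet_derivative (\<lambda>y. frechet_derivative ?\<tau> (at y) w) (at ?x)) (at ?x)"
        by (rule smooth_on_has_derivative[OF smooth_on_directional_derivative[OF \<tau>] U(2)])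
    qed
    then have "((\<lambda>y. local_form A \<alpha> c y w) has_derivative
      (\<lambda>u. frechet_derivative (\<lambda>z. ?b z (jacobian c d p w)) (at (?\<tau> ?x)) (jacobian c d p u)
         + ?b (?\<tau> ?x) (frechet_derivative (\<lambda>y. frechet_derivative ?\<tau> (at y) w) (at ?x) u))) (at ?x)"
    proof (rule has_derivative_transform_within_open[OF _ U])
      fix y assume "y \<in> ?U"
      then obtain q where q: "y = chart_map c q" "q \<in> chart_dom c" "q \<in> chart_dom d" by blast
      then have "c \<in> charts_at A q" "d \<in> charts_at A q" using cd by (auto simp: charts_at_def)
      from local_form_change_chart[OF A this]
      show "?b (?\<tau> y) (frechet_derivative ?\<tau> (at y) w) = local_form A \<alpha> c y w"
        using q cd by (simp add: transition_chart_map)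
    qed
    then show ?thesis
      unfolding \<tau>x by (rule frechet_derivative_eq)
  qed
  show ?thesis
    unfolding coord_ext_deriv_def key second_derivative_symmetric[OF \<tau> U, of u v] by simp
qed

text \<open>The exterior derivative may be computed in any chart. This is indispensable below: the chart chosen
  at \<open>p\<close> in \<open>M\<close> and the one chosen at \<open>(s, p)\<close> in the symplectization are unrelated.\<close>

lemma ext_deriv_in_chart:
  assumes "smooth_atlas A" "is_one_form A \<alpha>" "c \<in> charts_at A p"
    and "u \<in> tangent_space A p" "v \<in> tangent_space A p"
  shows "ext_deriv A \<alpha> p u v = coord_ext_deriv A \<alpha> c (chart_map c p) (u c) (v c)"
proof -
  let ?d = "chart_at A p"
  have d: "?d \<in> charts_at A p" using assms(1) by (rule chart_at_in_charts_at)
  have "u ?d = jacobian c ?d p (u c)" "v ?d = jacobian c ?d p (v c)"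
    using assms(3-5) d unfolding tangent_space_def by blast+
  then show ?thesis
    unfolding ext_deriv_def Let_def coord_ext_deriv_change_chart[OF assms(1-3) d]
    by (simp only: coord_ext_deriv_def)
qed

lemma one_form_in_chart:
  assumes "c \<in> charts_at A p" "is_chart c" "v \<in> tangent_space A p"
  shows "\<alpha> p v = local_form A \<alpha> c (chart_map c p) (v c)"
proof -
  have "chart_inv c (chart_map c p) = p"
    using assms by (simp add: charts_at_def chart_inv_map)
  then show ?thesis
    using tangent_space_eq_coord_tvec[OF assms(3,1)] by (simp only: local_form_def)
qed

section \<open>Charts of the symplectization\<close>

abbreviation cylinder_chart :: "('m, 'e) chart \<Rightarrow> (real \<times> 'm, real \<times> 'e) chart" where
  "cylinder_chart c \<equiv> prod_chart (UNIV, id) c"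

lemma symplectization_atlas_eq: "symplectization_atlas A = cylinder_chart ` A"
  by (auto simp: symplectization_atlas_def prod_atlas_def real_atlas_def)

lemma chart_dom_cylinder_chart: "chart_dom (cylinder_chart c) = UNIV \<times> chart_dom c"
  by (simp add: prod_chart_def)

lemma chart_map_cylinder_chart: "chart_map (cylinder_chart c) (s, p) = (s, chart_map c p)"
  by (simp add: prod_chart_def)

lemma chart_map_cylinder_chart_image:
  "chart_map (cylinder_chart c) ` (UNIV \<times> X) = UNIV \<times> chart_map c ` X"
proof (intro equalityI subsetI)
  fix z :: "real \<times> _" assume "z \<in> UNIV \<times> chart_map c ` X"
  then obtain x where "x \<in> X" "z = chart_map (cylinder_chart c) (fst z, x)"
    by (auto simp: chart_map_cylinder_chart)
  then show "z \<in> chart_map (cylinder_chart c) ` (UNIV \<times> X)" by blast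
qed (auto simp: chart_map_cylinder_chart)

lemma chart_image_cylinder_chart: "chart_image (cylinder_chart c) = UNIV \<times> chart_image c"
  unfolding chart_image_def chart_dom_cylinder_chart chart_map_cylinder_chart_image ..

lemmas cylinder_chart_simps =
  chart_dom_cylinder_chart chart_map_cylinder_chart chart_image_cylinder_chart

lemma chart_inv_cylinder_chart:
  assumes "is_chart c" "y \<in> chart_image c"
  shows "chart_inv (cylinder_chart c) (s, y) = (s, chart_inv c y)"
  unfolding chart_inv_def[of "cylinder_chart c"]
proof (rule inv_into_f_eq)
  show "inj_on (chart_map (cylinder_chart c)) (chart_dom (cylinder_chart c))"
    using chart_inv_map[OF assms(1)]
    by (intro inj_on_inverseI[where g = "map_prod id (chart_inv c)"]) (auto simp: cylinder_chart_simps)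
qed (use assms in \<open>auto simp: cylinder_chart_simps chart_inv_in_dom chart_map_inv\<close>)

lemma is_chart_cylinder_chart:
  assumes "is_chart c"
  shows "is_chart (cylinder_chart c)"
proof -
  let ?f = "chart_map (cylinder_chart c)" and ?g = "chart_inv (cylinder_chart c)"
  let ?D = "(UNIV :: real set) \<times> chart_dom c" and ?E = "(UNIV :: real set) \<times> chart_image c"
  have cont: "continuous_on (chart_dom c) (chart_map c)" "continuous_on (chart_image c) (chart_inv c)"
    and op: "open (chart_dom c)" "open (chart_image c)"
    using assms unfolding is_chart_def homeomorphism_def by blast+
  have g: "?g (s, y) = (s, chart_inv c y)" if "y \<in> chart_image c" for s y
    using chart_inv_cylinder_chart[OF assms that] .
  have "continuous_on ?D (\<lambda>z. (fst z, chart_map c (snd z)))"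
    by (intro continuous_intros continuous_on_compose2[OF cont(1)]) auto
  then have "continuous_on ?D ?f"
    by (rule continuous_on_eq) (auto simp only: chart_map_cylinder_chart fst_conv snd_conv)
  moreover have "continuous_on ?E (\<lambda>z. (fst z, chart_inv c (snd z)))"
    by (intro continuous_intros continuous_on_compose2[OF cont(2)]) auto
  then have "continuous_on ?E ?g"
    by (rule continuous_on_eq) (auto simp only: g fst_conv snd_conv)
  moreover have "?g (?f (s, p)) = (s, p)" if "p \<in> chart_dom c" for s p
    using that g[of "chart_map c p" s] chart_inv_map[OF assms that]
    by (simp only: chart_map_cylinder_chart chart_image_def imageI)
  moreover have "?f (?g (s, y)) = (s, y)" if "y \<in> chart_image c" for s y
    using g[OF that, of s] chart_map_inv[OF assms that] by (simp only: chart_map_cylinder_chart)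
  moreover have "?f ` ?D = ?E"
    by (simp only: chart_map_cylinder_chart_image chart_image_def)
  moreover have "?g ` ?E \<subseteq> ?D"
    using chart_inv_in_dom[OF assms] by (auto simp only: g image_subset_iff mem_Times_iff fst_conv snd_conv)
  ultimately have "homeomorphism ?D ?E ?f ?g"
    by (intro homeomorphismI) (simp_all only: subset_refl mem_Times_iff split_paired_all fst_conv snd_conv)
  then show ?thesis
    using op by (simp add: is_chart_def cylinder_chart_simps open_Times)
qed

lemma transition_cylinder_chart:
  assumes "is_chart c" "y \<in> chart_image c"
  shows "transition (cylinder_chart c) (cylinder_chart d) (s, y) = (s, transition c d y)"
  using assms by (simp add: transition_def chart_inv_cylinder_chart chart_map_cylinder_chart)

lemma cylinder_overlap:
  "chart_map (cylinder_chart c) ` (chart_dom (cylinder_chart c) \<inter> chart_dom (cylinder_chart d))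
     = UNIV \<times> chart_map c ` (chart_dom c \<inter> chart_dom d)"
proof -
  have "chart_dom (cylinder_chart c) \<inter> chart_dom (cylinder_chart d) = UNIV \<times> (chart_dom c \<inter> chart_dom d)"
    by (auto simp: chart_dom_cylinder_chart)
  then show ?thesis by (simp only: chart_map_cylinder_chart_image)
qed

lemma smooth_on_transition_cylinder_chart:
  assumes "is_chart c" "is_chart d" "compatible c d"
  shows "smooth_on (UNIV \<times> chart_map c ` (chart_dom c \<inter> chart_dom d))
    (transition (cylinder_chart c) (cylinder_chart d))"
proof -
  let ?U = "chart_map c ` (chart_dom c \<inter> chart_dom d)"
  have U: "open ((UNIV :: real set) \<times> ?U)"
    using assms by (intro open_Times open_chart_map_image) (auto simp: is_chart_def)
  have "smooth_on ((UNIV :: real set) \<times> ?U) (\<lambda>z. 0 + fst z)"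
    by (rule smooth_on_affine[OF U linear_fst])
  moreover have "smooth_on ((UNIV :: real set) \<times> ?U) (\<lambda>z. transition c d (0 + snd z))"
    by (rule smooth_on_compose_affine[OF _ U linear_snd]) (use assms in \<open>auto simp: compatible_def\<close>)
  ultimately have "smooth_on ((UNIV :: real set) \<times> ?U) (\<lambda>z. (0 + fst z, transition c d (0 + snd z)))"
    using U by (rule smooth_on_Pair)
  then show ?thesis
  proof (rule smooth_on_cong[OF _ U])
    fix z :: "real \<times> 'b" assume "z \<in> UNIV \<times> ?U"
    then have "snd z \<in> chart_image c" by (auto simp: chart_image_def)
    then show "(0 + fst z, transition c d (0 + snd z))
        = transition (cylinder_chart c) (cylinder_chart d) z"
      using transition_cylinder_chart[OF assms(1), of "snd z" d "fst z"] by simp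
  qed
qed

lemma compatible_cylinder_chart:
  assumes "is_chart c" "is_chart d" "compatible c d"
  shows "compatible (cylinder_chart c) (cylinder_chart d)"
proof -
  have "chart_map (cylinder_chart d) ` (chart_dom (cylinder_chart c) \<inter> chart_dom (cylinder_chart d))
      = UNIV \<times> chart_map d ` (chart_dom d \<inter> chart_dom c)"
    using cylinder_overlap[of d c] by (simp only: Int_commute)
  then show ?thesis
    unfolding compatible_def cylinder_overlap
    using smooth_on_transition_cylinder_chart[OF assms]
      smooth_on_transition_cylinder_chart[OF assms(2,1) compatible_sym[OF assms(3)]]
    by (simp only:)
qed

lemma smooth_atlas_symplectization:
  assumes "smooth_atlas A"
  shows "smooth_atlas (symplectization_atlas A)"
proof -
  have "(\<Union>c\<in>A. chart_dom c) = UNIV" using assms by (simp add: smooth_atlas_def)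
  moreover have "(\<Union>c\<in>A. UNIV \<times> chart_dom c) = UNIV \<times> (\<Union>c\<in>A. chart_dom c)" by blast
  ultimately have "(\<Union>c\<in>A. UNIV \<times> chart_dom c) = UNIV" by simp
  then show ?thesis
    using assms unfolding smooth_atlas_def symplectization_atlas_eq
    by (auto simp only: ball_simps image_image chart_dom_cylinder_chart
        intro: is_chart_cylinder_chart compatible_cylinder_chart)
qed

lemma smooth_chart_cylinder_chart:
  assumes "smooth_atlas A" "smooth_chart A c"
  shows "smooth_chart (symplectization_atlas A) (cylinder_chart c)"
  using assms by (simp add: smooth_atlas_def smooth_chart_def symplectization_atlas_eq
      is_chart_cylinder_chart compatible_cylinder_chart)

lemma charts_at_symplectization:
  "charts_at (symplectization_atlas A) (s, p) = cylinder_chart ` charts_at A p"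
  by (auto simp: charts_at_def symplectization_atlas_eq chart_dom_cylinder_chart)

lemma jacobian_cylinder_chart:
  assumes "is_chart c" "compatible c d" "p \<in> chart_dom c" "p \<in> chart_dom d"
  shows "jacobian (cylinder_chart c) (cylinder_chart d) (s, p) (a, w) = (a, jacobian c d p w)"
proof -
  let ?x = "chart_map (cylinder_chart c) (s, p)"
  have "((\<lambda>z. transition c d (snd z)) has_derivative (\<lambda>z. jacobian c d p (snd z))) (at ?x)"
    using diff_chain_at[OF bounded_linear_imp_has_derivative[OF bounded_linear_snd],
        of "transition c d" "jacobian c d p" ?x] has_derivative_jacobian[OF assms(2-4)]
    by (simp add: o_def chart_map_cylinder_chart)
  then have "((\<lambda>z. (fst z, transition c d (snd z))) has_derivative
      (\<lambda>z. (fst z, jacobian c d p (snd z)))) (at ?x)"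
    by (intro has_derivative_Pair has_derivative_fst has_derivative_ident)
  then have "(transition (cylinder_chart c) (cylinder_chart d) has_derivative
      (\<lambda>z. (fst z, jacobian c d p (snd z)))) (at ?x)"
  proof (rule has_derivative_transform_within_open)
    show "open ((UNIV :: real set) \<times> chart_image c)"
      using assms by (intro open_Times) (auto simp: is_chart_def)
  qed (use assms in \<open>auto simp: chart_map_cylinder_chart transition_cylinder_chart chart_image_def\<close>)
  from frechet_derivative_eq[OF this] show ?thesis by simp
qed

section \<open>The symplectic form in coordinates\<close>

text \<open>The differential of the projection to \<open>M\<close> forgets the \<open>\<theta>\<close>-component. The pushforward is computed
  in a chart \<open>e\<close> chosen at \<open>(s, p)\<close>, hence the detour from \<open>c\<close> over \<open>e\<close> to \<open>d\<close>.\<close>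

lemma pushforward_snd_coord_tvec:
  assumes A: "smooth_atlas A" and c: "c \<in> charts_at A p"
  shows "pushforward (symplectization_atlas A) A snd (s, p)
      (coord_tvec (symplectization_atlas A) (cylinder_chart c) (s, p) (b, w)) = coord_tvec A c p w"
proof
  fix d
  let ?S = "symplectization_atlas A"
  obtain e where e: "e \<in> charts_at A p" "chart_at ?S (s, p) = cylinder_chart e"
    using chart_at_in_charts_at[OF smooth_atlas_symplectization[OF A], of "(s, p)"]
    unfolding charts_at_symplectization by blast
  have ce: "is_chart c" "is_chart e" "compatible c e" "p \<in> chart_dom c" "p \<in> chart_dom e"
    using A c e(1) by (auto simp: smooth_atlas_def charts_at_def)
  have "cylinder_chart e \<in> charts_at ?S (s, p)"
    using e(1) by (auto simp: charts_at_symplectization)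
  then have v: "coord_tvec ?S (cylinder_chart c) (s, p) (b, w) (cylinder_chart e) = (b, jacobian c e p w)"
    using jacobian_cylinder_chart[OF ce(1,3,4,5)] by (simp add: coord_tvec_def)
  show "pushforward ?S A snd (s, p) (coord_tvec ?S (cylinder_chart c) (s, p) (b, w)) d
      = coord_tvec A c p w d"
  proof (cases "d \<in> charts_at A p")
    case True
    then have ed: "compatible e d" "p \<in> chart_dom d"
      using A e(1) by (auto simp: smooth_atlas_def charts_at_def)
    let ?x = "chart_map (cylinder_chart e) (s, p)"
    have "(transition e d \<circ> snd has_derivative jacobian e d p \<circ> snd) (at ?x)"
      using has_derivative_jacobian[OF ed(1) ce(5) ed(2)]
      by (intro diff_chain_at bounded_linear_imp_has_derivative[OF bounded_linear_snd])
         (simp add: chart_map_cylinder_chart)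
    then have "(chart_map d \<circ> snd \<circ> chart_inv (cylinder_chart e) has_derivative jacobian e d p \<circ> snd) (at ?x)"
    proof (rule has_derivative_transform_within_open)
      show "open ((UNIV :: real set) \<times> chart_image e)"
        using ce by (intro open_Times) (auto simp: is_chart_def)
    qed (use ce in \<open>auto simp: chart_map_cylinder_chart chart_inv_cylinder_chart transition_def chart_image_def\<close>)
    from frechet_derivative_eq[OF this, of "(b, jacobian c e p w)"]
    have "frechet_derivative (chart_map d \<circ> snd \<circ> chart_inv (cylinder_chart e)) (at ?x) (b, jacobian c e p w)
        = jacobian c d p w"
      using jacobian_compose[OF ce(1-3) ed(1) ce(4,5) ed(2)] by simp
    then show ?thesis
      using True by (simp add: pushforward_def Let_def e(2) v coord_tvec_def[of A])
  next
    case False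
    then show ?thesis by (simp add: pushforward_def Let_def coord_tvec_def[of A])
  qed
qed

text \<open>The one-form \<open>e\<^sup>\<theta> \<alpha>\<close>, whose exterior derivative is \<open>symplectization_form\<close>.\<close>

definition liouville_form ::
    "('m, 'e::euclidean_space) chart set \<Rightarrow> ('m, 'e) one_form \<Rightarrow> (real \<times> 'm, real \<times> 'e) one_form" where
  "liouville_form A \<alpha> = (\<lambda>x v. exp (fst x) * pullback (symplectization_atlas A) A snd \<alpha> x v)"

lemma local_form_liouville_form:
  assumes "smooth_atlas A" "c \<in> A" "y \<in> chart_image c"
  shows "local_form (symplectization_atlas A) (liouville_form A \<alpha>) (cylinder_chart c) (s, y) (b, w)
       = exp s * local_form A \<alpha> c y w"
proof -
  have c: "is_chart c" using assms by (simp add: smooth_atlas_def)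
  then have "c \<in> charts_at A (chart_inv c y)"
    using assms by (simp add: charts_at_def chart_inv_in_dom)
  then show ?thesis
    using assms c
    by (simp add: local_form_def liouville_form_def pullback_def chart_inv_cylinder_chart
        pushforward_snd_coord_tvec)
qed

text \<open>The identity \<open>d(e\<^sup>\<theta> \<alpha>) = e\<^sup>\<theta> (d\<theta> \<and> \<alpha> + d\<alpha>)\<close> in coordinates.\<close>

lemma coord_ext_deriv_liouville_form:
  assumes "smooth_atlas A" "is_one_form A \<alpha>" "c \<in> A" "x \<in> chart_image c"
  shows "coord_ext_deriv (symplectization_atlas A) (liouville_form A \<alpha>) (cylinder_chart c)
      (s, x) (a, u) (b, w)
    = exp s * (a * local_form A \<alpha> c x w - b * local_form A \<alpha> c x u + coord_ext_deriv A \<alpha> c x u w)"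
proof -
  let ?a = "local_form A \<alpha> c"
  let ?L = "local_form (symplectization_atlas A) (liouville_form A \<alpha>) (cylinder_chart c)"
  have "frechet_derivative (\<lambda>z. ?L z (b, w)) (at (s, x)) (a, u)
      = exp s * a * ?a x w + exp s * frechet_derivative (\<lambda>y. ?a y w) (at x) u" for a u b w
  proof -
    have "((\<lambda>y. ?a y w) has_derivative frechet_derivative (\<lambda>y. ?a y w) (at x)) (at (snd (s, x)))"
      using local_form_differentiable[OF assms(2-4)] by (simp add: frechet_derivative_works)
    from diff_chain_at[OF bounded_linear_imp_has_derivative[OF bounded_linear_snd] this]
    have "((\<lambda>z. ?a (snd z) w) has_derivative
        (\<lambda>z. frechet_derivative (\<lambda>y. ?a y w) (at x) (snd z))) (at (s, x))"
      by (simp add: o_def)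
    moreover have "((\<lambda>z. exp (fst z)) has_derivative (\<lambda>z. exp s * fst z)) (at (s, x))"
      by (auto intro!: derivative_eq_intros)
    ultimately have "((\<lambda>z. exp (fst z) * ?a (snd z) w) has_derivative
        (\<lambda>z. exp (fst (s, x)) * frechet_derivative (\<lambda>y. ?a y w) (at x) (snd z)
           + exp s * fst z * ?a (snd (s, x)) w)) (at (s, x))"
      by (intro has_derivative_mult)
    then have "((\<lambda>z. ?L z (b, w)) has_derivative
        (\<lambda>z. exp (fst (s, x)) * frechet_derivative (\<lambda>y. ?a y w) (at x) (snd z)
           + exp s * fst z * ?a (snd (s, x)) w)) (at (s, x))"
    proof (rule has_derivative_transform_within_open)
      show "open ((UNIV :: real set) \<times> chart_image c)"
        using assms by (intro open_Times) (auto simp: smooth_atlas_def is_chart_def)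
    qed (use assms in \<open>auto simp: local_form_liouville_form\<close>)
    from frechet_derivative_eq[OF this] show ?thesis by simp
  qed
  then show ?thesis
    by (simp add: coord_ext_deriv_def[of "symplectization_atlas A"] coord_ext_deriv_def[of A] algebra_simps)
qed

text \<open>The chart chosen at \<open>(s, p)\<close> is the cylinder over some chart \<open>d\<close>. The terms of the formula are
  carried from \<open>d\<close> to \<open>c\<close>, so that \<open>c\<close> can be a chart in which \<open>d\<alpha>\<close> is computed on \<open>M\<close> as well.\<close>

lemma symplectization_form_in_chart:
  assumes "smooth_atlas A" "is_one_form A \<alpha>" "c \<in> charts_at A p"
    and u: "u \<in> tangent_space (symplectization_atlas A) (s, p)"
    and v: "v \<in> tangent_space (symplectization_atlas A) (s, p)"
  shows "symplectization_form A \<alpha> (s, p) u v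
    = exp s * (fst (u (cylinder_chart c)) * local_form A \<alpha> c (chart_map c p) (snd (v (cylinder_chart c)))
             - fst (v (cylinder_chart c)) * local_form A \<alpha> c (chart_map c p) (snd (u (cylinder_chart c)))
             + coord_ext_deriv A \<alpha> c (chart_map c p) (snd (u (cylinder_chart c))) (snd (v (cylinder_chart c))))"
proof -
  let ?S = "symplectization_atlas A"
  obtain d where d: "d \<in> charts_at A p" "chart_at ?S (s, p) = cylinder_chart d"
    using chart_at_in_charts_at[OF smooth_atlas_symplectization[OF assms(1)], of "(s, p)"]
    unfolding charts_at_symplectization by blast
  have cd: "is_chart c" "c \<in> A" "d \<in> A" "compatible c d" "p \<in> chart_dom c" "p \<in> chart_dom d"
    using assms(1,3) d(1) by (auto simp: smooth_atlas_def charts_at_def)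
  have coords: "z (cylinder_chart d) = (fst (z (cylinder_chart c)), jacobian c d p (snd (z (cylinder_chart c))))"
    if "z \<in> tangent_space ?S (s, p)" for z
  proof -
    have "z (cylinder_chart d) = jacobian (cylinder_chart c) (cylinder_chart d) (s, p) (z (cylinder_chart c))"
      using that assms(3) d(1) unfolding tangent_space_def charts_at_symplectization by blast
    then show ?thesis
      using jacobian_cylinder_chart[OF cd(1,4-6), of s "fst (z (cylinder_chart c))" "snd (z (cylinder_chart c))"]
      by simp
  qed
  have "symplectization_form A \<alpha> (s, p) u v
      = coord_ext_deriv ?S (liouville_form A \<alpha>) (cylinder_chart d) (s, chart_map d p)
          (u (cylinder_chart d)) (v (cylinder_chart d))"
    by (simp only: symplectization_form_def liouville_form_def[symmetric] ext_deriv_def Let_def d(2)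
        coord_ext_deriv_def chart_map_cylinder_chart)
  also have "\<dots> = exp s *
      (fst (u (cylinder_chart c)) * local_form A \<alpha> d (chart_map d p) (jacobian c d p (snd (v (cylinder_chart c))))
     - fst (v (cylinder_chart c)) * local_form A \<alpha> d (chart_map d p) (jacobian c d p (snd (u (cylinder_chart c))))
     + coord_ext_deriv A \<alpha> d (chart_map d p)
         (jacobian c d p (snd (u (cylinder_chart c)))) (jacobian c d p (snd (v (cylinder_chart c)))))"
    unfolding coords[OF u] coords[OF v]
    by (rule coord_ext_deriv_liouville_form[OF assms(1,2) cd(3)]) (use cd in \<open>simp add: chart_image_def\<close>)
  finally show ?thesis
    by (simp only: local_form_change_chart[OF assms(1,3) d(1)]
        coord_ext_deriv_change_chart[OF assms(1-3) d(1)])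
qed

section \<open>Cylinders over submanifolds\<close>

lemma slice_cylinder_chart:
  assumes "chart_map c ` (chart_dom c \<inter> Y) = chart_image c \<inter> S"
  shows "chart_map (cylinder_chart c) ` (chart_dom (cylinder_chart c) \<inter> (UNIV \<times> Y))
       = chart_image (cylinder_chart c) \<inter> (UNIV \<times> S)"
proof -
  have "chart_dom (cylinder_chart c) \<inter> (UNIV \<times> Y) = UNIV \<times> (chart_dom c \<inter> Y)"
    by (auto simp: chart_dom_cylinder_chart)
  moreover have "chart_image (cylinder_chart c) \<inter> (UNIV \<times> S) = UNIV \<times> (chart_image c \<inter> S)"
    by (auto simp: chart_image_cylinder_chart)
  ultimately show ?thesis
    by (simp only: chart_map_cylinder_chart_image assms)
qed

lemma slice_chartE:
  assumes "slice_chart A Y k c"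
  obtains S where "smooth_chart A c" "subspace S" "dim S = k"
    "chart_map c ` (chart_dom c \<inter> Y) = chart_image c \<inter> S"
  using assms unfolding slice_chart_def smooth_chart_def by blast

lemma submanifold_cylinder:
  assumes "smooth_atlas A" "submanifold A Y"
  shows "submanifold (symplectization_atlas A) (UNIV \<times> Y)"
proof -
  obtain k where k: "\<And>p. p \<in> Y \<Longrightarrow> \<exists>c. slice_chart A Y k c \<and> p \<in> chart_dom c"
    using assms(2) unfolding submanifold_def by blast
  have "\<exists>d. slice_chart (symplectization_atlas A) (UNIV \<times> Y) (Suc k) d \<and> (s, p) \<in> chart_dom d"
    if "p \<in> Y" for s :: real and p
  proof -
    obtain c where c: "slice_chart A Y k c" "p \<in> chart_dom c" using k[OF \<open>p \<in> Y\<close>] by blast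
    from c(1) obtain S where S: "smooth_chart A c" "subspace S" "dim S = k"
      "chart_map c ` (chart_dom c \<inter> Y) = chart_image c \<inter> S"
      by (rule slice_chartE)
    have "smooth_chart (symplectization_atlas A) (cylinder_chart c)"
      by (rule smooth_chart_cylinder_chart[OF assms(1) S(1)])
    moreover have "subspace ((UNIV :: real set) \<times> S)"
      using S(2) by (intro subspace_Times) auto
    moreover have "dim ((UNIV :: real set) \<times> S) = Suc k"
      using S(2,3) by (simp add: dim_Times)
    moreover have "(s, p) \<in> chart_dom (cylinder_chart c)"
      using c(2) by (simp add: chart_dom_cylinder_chart)
    ultimately show ?thesis
      using slice_cylinder_chart[OF S(4)] unfolding slice_chart_def smooth_chart_def by blast
  qed
  then show ?thesis unfolding submanifold_def by blast
qed

section \<open>Coisotropic subspaces\<close>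

text \<open>The linear algebra of the theorem, for a linear form \<open>a\<close> in the role of \<open>\<alpha>\<close>, a form \<open>\<beta>\<close> in the role
  of \<open>d\<alpha>\<close>, and the tangent space \<open>K\<close> of \<open>Y\<close>. The vector \<open>(s, x)\<close> is orthogonal to \<open>\<real> \<times> K\<close> exactly when
  \<open>a x = 0\<close> (pair with \<open>(1, 0)\<close>) and \<open>s * a w + \<beta> x w = 0\<close> for all \<open>w \<in> K\<close>. The latter implies
  \<open>\<beta> x w = 0\<close> on \<open>K \<inter> ker a\<close>. Conversely, if \<open>\<beta> x\<close> vanishes on \<open>K \<inter> ker a\<close>, then it is a
  multiple of \<open>a\<close> on \<open>K\<close>, and the factor determines a suitable \<open>s\<close>.\<close>

lemma linear_coisotropic_iff:
  fixes a :: "'e::real_vector \<Rightarrow> real" and \<beta> :: "'e \<Rightarrow> 'e \<Rightarrow> real"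
  assumes a: "linear a" and \<beta>: "\<And>x. linear (\<beta> x)" and K: "subspace K"
  shows "(\<forall>x. a x = 0 \<and> (\<forall>w\<in>K. a w = 0 \<longrightarrow> \<beta> x w = 0) \<longrightarrow> x \<in> K) \<longleftrightarrow>
    (\<forall>s x. (\<forall>t. \<forall>w\<in>K. s * a w - t * a x + \<beta> x w = 0) \<longrightarrow> x \<in> K)"
    (is "?contact \<longleftrightarrow> ?symplectic")
proof
  assume contact: ?contact
  show ?symplectic
  proof (intro allI impI)
    fix s x assume orth: "\<forall>t. \<forall>w\<in>K. s * a w - t * a x + \<beta> x w = 0"
    have zero: "0 \<in> K" using K by (rule subspace_0)
    \<comment> \<open>Pairing with \<open>(-1, 0)\<close> isolates \<open>a x\<close>.\<close>
    have "s * a 0 - (- 1) * a x + \<beta> x 0 = 0" using orth zero by blast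
    then have "a x = 0"
      using linear_0[OF a] linear_0[OF \<beta>[of x]] by simp
    moreover have "\<beta> x w = 0" if "w \<in> K" "a w = 0" for w
    proof -
      have "s * a w - 0 * a x + \<beta> x w = 0" using orth that(1) by blast
      then show ?thesis using that(2) by simp
    qed
    ultimately show "x \<in> K" using contact by blast
  qed
next
  assume symplectic: ?symplectic
  show ?contact
  proof (intro allI impI, elim conjE)
    fix x assume x: "a x = 0" and orth: "\<forall>w\<in>K. a w = 0 \<longrightarrow> \<beta> x w = 0"
    \<comment> \<open>On \<open>K\<close>, the form \<open>\<beta> x\<close> is a multiple of \<open>a\<close>, because it vanishes on the kernel of \<open>a\<close> there.\<close>
    obtain s where s: "\<And>w. w \<in> K \<Longrightarrow> s * a w + \<beta> x w = 0"
    proof (cases "\<exists>w0\<in>K. a w0 \<noteq> 0")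
      case False
      with orth show ?thesis by (intro that[of 0]) auto
    next
      case True
      then obtain w0 where w0: "w0 \<in> K" "a w0 \<noteq> 0" by blast
      show ?thesis
      proof (rule that[of "- \<beta> x w0 / a w0"])
        fix w assume w: "w \<in> K"
        \<comment> \<open>The projection of \<open>w\<close> to \<open>K \<inter> ker a\<close> along \<open>w0\<close>.\<close>
        let ?w = "w - (a w / a w0) *\<^sub>R w0"
        have "?w \<in> K" using K w w0(1) by (intro subspace_diff subspace_scale)
        moreover have "a ?w = 0" using w0(2) by (simp add: linear_diff[OF a] linear_cmul[OF a])
        ultimately have "\<beta> x ?w = 0" using orth by blast
        then show "- \<beta> x w0 / a w0 * a w + \<beta> x w = 0"
          by (simp add: linear_diff[OF \<beta>] linear_cmul[OF \<beta>] mult.commute)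
      qed
    qed
    have "\<forall>t. \<forall>w\<in>K. s * a w - t * a x + \<beta> x w = 0" using s x by simp
    then show "x \<in> K" using symplectic by blast
  qed
qed

text \<open>A chart identifies the tangent space with the coordinate space, so the condition becomes one about
  the linear subspace \<open>K\<close> that represents \<open>W\<close>.\<close>

lemma contact_coisotropic_condition_in_chart:
  assumes A: "smooth_atlas A" and \<alpha>: "is_one_form A \<alpha>" and c: "c \<in> charts_at A p"
    and W: "\<And>v. v \<in> W \<longleftrightarrow> v \<in> tangent_space A p \<and> v c \<in> K"
  shows "orth_compl (contact_hyperplane A \<alpha> p) (ext_deriv A \<alpha> p) (W \<inter> contact_hyperplane A \<alpha> p)
      \<subseteq> W \<inter> contact_hyperplane A \<alpha> p \<longleftrightarrow>
    (\<forall>x. local_form A \<alpha> c (chart_map c p) x = 0 \<and>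
       (\<forall>w\<in>K. local_form A \<alpha> c (chart_map c p) w = 0 \<longrightarrow> coord_ext_deriv A \<alpha> c (chart_map c p) x w = 0)
       \<longrightarrow> x \<in> K)"
    (is "?L \<longleftrightarrow> (\<forall>x. ?a x = 0 \<and> (\<forall>w\<in>K. ?a w = 0 \<longrightarrow> ?\<beta> x w = 0) \<longrightarrow> x \<in> K)")
proof -
  let ?T = "tangent_space A p" and ?H = "contact_hyperplane A \<alpha> p"
  have chart: "smooth_chart A c" "is_chart c" "p \<in> chart_dom c"
    using A c by (auto simp: charts_at_def smooth_atlas_def smooth_chart_def)
  have H: "v \<in> ?H \<longleftrightarrow> v \<in> ?T \<and> ?a (v c) = 0" for v
    using one_form_in_chart[OF c chart(2), of v \<alpha>] by (auto simp: contact_hyperplane_def)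
  have lift: "coord_tvec A c p x \<in> ?T" "coord_tvec A c p x c = x" for x
    using smooth_chart_coord_tvec_in_tangent_space[OF A chart(1,3)] coord_tvec_at_chart[OF chart(1) c]
    by auto
  note d\<alpha> = ext_deriv_in_chart[OF A \<alpha> c]
  show ?thesis
  proof
    assume L: ?L
    show "\<forall>x. ?a x = 0 \<and> (\<forall>w\<in>K. ?a w = 0 \<longrightarrow> ?\<beta> x w = 0) \<longrightarrow> x \<in> K"
    proof (intro allI impI, elim conjE)
      fix x assume x: "?a x = 0" "\<forall>w\<in>K. ?a w = 0 \<longrightarrow> ?\<beta> x w = 0"
      let ?v = "coord_tvec A c p x"
      have "ext_deriv A \<alpha> p ?v w = 0" if "w \<in> W \<inter> ?H" for w
      proof -
        have w: "w \<in> ?T" "w c \<in> K" "?a (w c) = 0" using that W H by blast+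
        then show ?thesis using x(2) d\<alpha>[OF lift(1)[of x] w(1)] by (simp add: lift(2))
      qed
      then have "?v \<in> orth_compl ?H (ext_deriv A \<alpha> p) (W \<inter> ?H)"
        using x(1) lift by (simp add: orth_compl_def H)
      then have "?v \<in> W" using L by blast
      then show "x \<in> K" using W lift(2) by simp
    qed
  next
    assume R: "\<forall>x. ?a x = 0 \<and> (\<forall>w\<in>K. ?a w = 0 \<longrightarrow> ?\<beta> x w = 0) \<longrightarrow> x \<in> K"
    show ?L
    proof
      fix v assume "v \<in> orth_compl ?H (ext_deriv A \<alpha> p) (W \<inter> ?H)"
      then have v: "v \<in> ?H" and orth: "\<And>w. w \<in> W \<inter> ?H \<Longrightarrow> ext_deriv A \<alpha> p v w = 0"
        by (auto simp: orth_compl_def)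
      have "?\<beta> (v c) w = 0" if "w \<in> K" "?a w = 0" for w
      proof -
        have "coord_tvec A c p w \<in> W \<inter> ?H" using that W H lift by simp
        from orth[OF this] show ?thesis
          using d\<alpha>[of v "coord_tvec A c p w"] v H lift by simp
      qed
      then have "v c \<in> K" using R v H by blast
      then show "v \<in> W \<inter> ?H" using v W H by blast
    qed
  qed
qed

lemma coisotropic_condition_in_chart:
  assumes A: "smooth_atlas A" and c: "c \<in> charts_at A p"
    and W: "\<And>v. v \<in> W \<longleftrightarrow> v \<in> tangent_space A p \<and> v c \<in> K"
    and \<omega>: "\<And>u v. u \<in> tangent_space A p \<Longrightarrow> v \<in> tangent_space A p \<Longrightarrow> \<omega> u v = B (u c) (v c)"
  shows "orth_compl (tangent_space A p) \<omega> W \<subseteq> W \<longleftrightarrow> (\<forall>x. (\<forall>w\<in>K. B x w = 0) \<longrightarrow> x \<in> K)"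
proof -
  let ?T = "tangent_space A p"
  have chart: "smooth_chart A c" "p \<in> chart_dom c"
    using A c by (auto simp: charts_at_def smooth_atlas_def smooth_chart_def)
  have lift: "coord_tvec A c p x \<in> ?T" "coord_tvec A c p x c = x" for x
    using smooth_chart_coord_tvec_in_tangent_space[OF A chart] coord_tvec_at_chart[OF chart(1) c]
    by auto
  show ?thesis
  proof
    assume L: "orth_compl ?T \<omega> W \<subseteq> W"
    show "\<forall>x. (\<forall>w\<in>K. B x w = 0) \<longrightarrow> x \<in> K"
    proof (intro allI impI)
      fix x assume x: "\<forall>w\<in>K. B x w = 0"
      let ?v = "coord_tvec A c p x"
      have "?v \<in> orth_compl ?T \<omega> W"
        using x \<omega>[OF lift(1)[of x]] by (simp add: orth_compl_def lift W)
      then have "?v \<in> W" using L by blast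
      then show "x \<in> K" using W lift(2) by simp
    qed
  next
    assume R: "\<forall>x. (\<forall>w\<in>K. B x w = 0) \<longrightarrow> x \<in> K"
    show "orth_compl ?T \<omega> W \<subseteq> W"
    proof
      fix v assume "v \<in> orth_compl ?T \<omega> W"
      then have v: "v \<in> ?T" and orth: "\<And>w. w \<in> W \<Longrightarrow> \<omega> v w = 0"
        by (auto simp: orth_compl_def)
      have "B (v c) w = 0" if "w \<in> K" for w
      proof -
        have "coord_tvec A c p w \<in> W" using that W lift by simp
        from orth[OF this] show ?thesis
          using \<omega>[OF v lift(1)[of w]] by (simp add: lift)
      qed
      then show "v \<in> W" using R v W by blast
    qed
  qed
qed

text \<open>Both conditions are read in one chart \<open>c\<close> of \<open>M\<close> and its cylinder chart, where \<open>Y\<close> and \<open>\<real> \<times> Y\<close> have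
  the tangent spaces \<open>K\<close> and \<open>\<real> \<times> K\<close>. The positive factor \<open>e\<^sup>s\<close> does not affect orthogonality.\<close>

lemma coisotropic_at_point_iff:
  assumes A: "smooth_atlas A" and \<alpha>: "is_one_form A \<alpha>" and Y: "submanifold A Y" and p: "p \<in> Y"
  shows "orth_compl (contact_hyperplane A \<alpha> p) (ext_deriv A \<alpha> p)
        (sub_tangent_space A Y p \<inter> contact_hyperplane A \<alpha> p)
      \<subseteq> sub_tangent_space A Y p \<inter> contact_hyperplane A \<alpha> p \<longleftrightarrow>
    orth_compl (tangent_space (symplectization_atlas A) (s, p)) (symplectization_form A \<alpha> (s, p))
        (sub_tangent_space (symplectization_atlas A) (UNIV \<times> Y) (s, p))
      \<subseteq> sub_tangent_space (symplectization_atlas A) (UNIV \<times> Y) (s, p)"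
proof -
  let ?S = "symplectization_atlas A"
  obtain k e where "slice_chart A Y k e" and pe: "p \<in> chart_dom e"
    using Y p unfolding submanifold_def by blast
  then obtain S where S: "smooth_chart A e" "subspace S"
    "chart_map e ` (chart_dom e \<inter> Y) = chart_image e \<inter> S"
    using slice_chartE by metis
  define c where "c = chart_at A p"
  have c: "c \<in> charts_at A p" unfolding c_def by (rule chart_at_in_charts_at[OF A])
  have chart: "c \<in> A" "is_chart c" "p \<in> chart_dom c" "compatible e c" "is_chart e"
    using A c S(1) by (auto simp: charts_at_def smooth_atlas_def smooth_chart_def)
  define K where "K = jacobian e c p ` S"
  have K: "subspace K"
    unfolding K_def by (rule linear_subspace_image[OF linear_jacobian[OF chart(4) pe chart(3)] S(2)])
  let ?a = "local_form A \<alpha> c (chart_map c p)" and ?\<beta> = "coord_ext_deriv A \<alpha> c (chart_map c p)"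
  have x: "chart_map c p \<in> chart_image c" using chart by (simp add: chart_image_def)
  have a: "linear ?a" using \<alpha> chart(1) x by (simp add: is_one_form_def)
  have W: "v \<in> sub_tangent_space A Y p \<longleftrightarrow> v \<in> tangent_space A p \<and> v c \<in> K" for v
    unfolding K_def by (rule mem_sub_tangent_space_iff[OF A S p pe c])
  have cyl: "cylinder_chart c \<in> charts_at ?S (s, p)"
    using c by (simp add: charts_at_symplectization)
  have "jacobian (cylinder_chart e) (cylinder_chart c) (s, p) ` (UNIV \<times> S) = UNIV \<times> K"
  proof -
    have J: "jacobian (cylinder_chart e) (cylinder_chart c) (s, p) z = (fst z, jacobian e c p (snd z))" for z
      using jacobian_cylinder_chart[OF chart(5,4) pe chart(3), of s "fst z" "snd z"] by simp
    show ?thesis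
      unfolding J K_def by force
  qed
  moreover have "v \<in> sub_tangent_space ?S (UNIV \<times> Y) (s, p) \<longleftrightarrow> v \<in> tangent_space ?S (s, p) \<and>
      v (cylinder_chart c) \<in> jacobian (cylinder_chart e) (cylinder_chart c) (s, p) ` (UNIV \<times> S)" for v
  proof (rule mem_sub_tangent_space_iff)
    show "smooth_atlas ?S" by (rule smooth_atlas_symplectization[OF A])
    show "smooth_chart ?S (cylinder_chart e)" by (rule smooth_chart_cylinder_chart[OF A S(1)])
    show "subspace ((UNIV :: real set) \<times> S)" using S(2) by (intro subspace_Times) auto
    show "(s, p) \<in> chart_dom (cylinder_chart e)" using pe by (simp add: chart_dom_cylinder_chart)
  qed (use p cyl slice_cylinder_chart[OF S(3)] in auto)
  ultimately have W': "v \<in> sub_tangent_space ?S (UNIV \<times> Y) (s, p) \<longleftrightarrow>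
      v \<in> tangent_space ?S (s, p) \<and> v (cylinder_chart c) \<in> UNIV \<times> K" for v
    by simp
  have "orth_compl (tangent_space ?S (s, p)) (symplectization_form A \<alpha> (s, p))
        (sub_tangent_space ?S (UNIV \<times> Y) (s, p)) \<subseteq> sub_tangent_space ?S (UNIV \<times> Y) (s, p) \<longleftrightarrow>
      (\<forall>x. (\<forall>w\<in>UNIV \<times> K. exp s * (fst x * ?a (snd w) - fst w * ?a (snd x) + ?\<beta> (snd x) (snd w)) = 0)
        \<longrightarrow> x \<in> UNIV \<times> K)"
    by (rule coisotropic_condition_in_chart[OF smooth_atlas_symplectization[OF A] cyl W'])
       (rule symplectization_form_in_chart[OF A \<alpha> c])
  also have "\<dots> \<longleftrightarrow> (\<forall>r x. (\<forall>t. \<forall>w\<in>K. r * ?a w - t * ?a x + ?\<beta> x w = 0) \<longrightarrow> x \<in> K)"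
    by (simp add: split_paired_all)
  also have "\<dots> \<longleftrightarrow> (\<forall>x. ?a x = 0 \<and> (\<forall>w\<in>K. ?a w = 0 \<longrightarrow> ?\<beta> x w = 0) \<longrightarrow> x \<in> K)"
    by (rule linear_coisotropic_iff[symmetric, OF a _ K])
       (rule linear_coord_ext_deriv_right[OF \<alpha> chart(1,2) x])
  also have "\<dots> \<longleftrightarrow> orth_compl (contact_hyperplane A \<alpha> p) (ext_deriv A \<alpha> p)
        (sub_tangent_space A Y p \<inter> contact_hyperplane A \<alpha> p)
      \<subseteq> sub_tangent_space A Y p \<inter> contact_hyperplane A \<alpha> p"
    by (rule contact_coisotropic_condition_in_chart[OF A \<alpha> c W, symmetric])
  finally show ?thesis by (rule sym)
qed

theorem proposition4p1:
  fixes A :: "('m::{t2_space, second_countable_topology}, 'e::euclidean_space) chart set"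
    and \<alpha> :: "('m, 'e) one_form"
    and n :: nat
    and Y :: "'m set"
  assumes "contact_manifold n A \<alpha>"
    and "submanifold A Y"
  shows "contact_coisotropic A \<alpha> Y \<longleftrightarrow>
    symplectic_coisotropic (symplectization_atlas A) (symplectization_form A \<alpha>) (UNIV \<times> Y)"
proof -
  have A: "smooth_atlas A" and \<alpha>: "is_one_form A \<alpha>"
    using assms(1) by (simp_all add: contact_manifold_def)
  note pointwise = coisotropic_at_point_iff[OF A \<alpha> assms(2)]
  have "symplectic_coisotropic (symplectization_atlas A) (symplectization_form A \<alpha>) (UNIV \<times> Y) \<longleftrightarrow>
    (\<forall>s. \<forall>p\<in>Y. orth_compl (tangent_space (symplectization_atlas A) (s, p)) (symplectization_form A \<alpha> (s, p))
        (sub_tangent_space (symplectization_atlas A) (UNIV \<times> Y) (s, p))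
      \<subseteq> sub_tangent_space (symplectization_atlas A) (UNIV \<times> Y) (s, p))"
    unfolding symplectic_coisotropic_def using submanifold_cylinder[OF A assms(2)] by blast
  also have "\<dots> \<longleftrightarrow> contact_coisotropic A \<alpha> Y"
    unfolding contact_coisotropic_def using assms(2) pointwise by blast
  finally show ?thesis by (rule sym)
qed

end
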